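(* Suppose that Assumption 1 and Assumption 2 (both stated in the context) hold. Then the two-level overlapping Schwarz preconditioner $$B^{-1}=\sum_{j=1}^N \Pi_jA_j^{-1}\Pi_j^*+\Pi_0A_0^{-1}\Pi_0^*$$ satisfies $$\kappa(B^{-1}A_h)\le C,$$ where $\kappa$ is the condition number and the positive constant $C$ depends only on $\Lambda$ and $M$ (the constants $\tilde C$, $C_{I_a}$, $C_{I_s}$ of Assumptions 1 and 2 being regarded as fixed).
   Context: Setting. $\Omega\subset\mathbb{R}^d$ ($d\ge1$) is a bounded polygonal (polyhedral) domain, $V(\Omega)$ is a complex Hilbert space of functions on $\Omega$, $a(\cdot,\cdot)$ is a sesquilinear Hermitian positive definite form, and $V_h$ is a finite-dimensional space of functions associated with a partition $\mathcal{T}_h$ of $\Omega$. With a fixed inner product $(\cdot,\cdot)$ on $V_h$, $A_h:V_h\to V_h$ is defined by $(A_hu,v)=a(u,v)$ for all $u,v\in V_h$. For a region $\mathcal D\subset\bar\Omega$, $a(\cdot,\cdot)_{\mathcal D}$ is the restriction of $a$ to $\mathcal D$ (nonnegative, additive over nonoverlapping regions), and $|u|_{a(\mathcal D)}^2=a(u,u)_{\mathcal D}$. The forms are understood to be defined also on products of functions of $V_h$ with the cutoff functions below. Subdomains. $\bar\Omega=\bigcup_{i=1}^N\bar\Omega_i$ with $\Omega_i\cap\Omega_j=\emptyset$ ($i\ne j$); $\Omega_i'\supset\Omega_i$ is obtained by extending $\Omega_i$ by several layers of elements of $\mathcal{T}_h$. Put $a_i=a(\cdot,\cdot)_{\bar\Omega_i}$,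 so $a=\sum_i a_i$; $V_h(\bar\Omega_i)=V_h|_{\bar\Omega_i}$, $n_i=\dim V_h(\bar\Omega_i)$; $V_h(\Omega_i')=\{u\in V_h:\mathrm{supp}(u)\subseteq\Omega_i'\}$; $\mathcal S^{(i)}=\{1\le j\le N:\Omega_j'\cap\Omega_i'\ne\emptyset\}$; $M=\max_i|\mathcal S^{(i)}|$. $\{\theta_i\}_{i=1}^N$ is a partition of unity: $\sum_i\theta_i=1$, $0\le\theta_i\le1$ on $\bar\Omega$, $\mathrm{supp}(\theta_i)\subset\bar\Omega_i'$. Assumption 1. There are sesquilinear Hermitian positive definite forms $s_i(\cdot,\cdot)$ on $V_h(\bar\Omega_i)$ and a constant $\tilde C>0$ with $a_i(\theta_ju,\theta_ju)\le\tilde C(a_i(u,u)+s_i(u,u))$ for all $u\in V_h$, $j\in\mathcal S^{(i)}$, $i=1,\dots,N$; and $\|\eta u\|_{s_i}\le\|\eta\|_{L^\infty(\bar\Omega_i)}\|u\|_{s_i}$ for all $\eta\in L^\infty(\bar\Omega_i)$, where $\|u\|_{s_i}=\sqrt{s_i(u,u)}$. Assumption 2. $I_h:L^2(\Omega)\to V_h$ is an interpolation operator (linear, $I_hv=v$ for $v\in V_h$, $I_h(\theta_iv)\in V_h(\Omega_i')$ for $v\in V_h$), and there are constants $C_{I_a},C_{I_s}$ such that for all $u\in V(\Omega)$: $a(I_hu,I_hu)_\tau\le C_{I_a}a(u,u)_\tau$ for all $\tau\in\mathcal T_h$, and $\sum_{l=1}^N\|I_hu\|_{s_l}^2\le C_{I_s}\sum_{l=1}^N\|u\|_{s_l}^2$.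 It is applied also to the products $\theta_iv$, $v\in V_h$. Coarse space. $\Lambda>1$ is a user-defined threshold. On each $\Omega_i$ consider $s_i(\phi,w)=\lambda a_i(\phi,w)$ for all $w\in V_h(\bar\Omega_i)$, whose $n_i$ eigenvalues are positive reals ordered as $\lambda_1^{(i)}\ge\dots\ge\lambda_{l_i}^{(i)}\ge\Lambda>\lambda_{l_i+1}^{(i)}\ge\dots\ge\lambda_{n_i}^{(i)}>0$, with eigenfunctions $\phi_j^{(i)}$ that are $s_i$-orthonormal and $a_i$-orthogonal. $V_{aux}^{(i)}=\mathrm{span}\{\phi_1^{(i)},\dots,\phi_{l_i}^{(i)}\}$. $\tilde V=\{v\in V_h: s_i(v,w)=0\ \forall w\in V_{aux}^{(i)},\ i=1,\dots,N\}$, and $V_0$ is the $a(\cdot,\cdot)$-orthogonal complement of $\tilde V$ in $V_h$. Operators. $A_j:V_h(\Omega_j')\to V_h(\Omega_j')$, $(A_ju,v)=a(u,v)_{\Omega_j'}$; $A_0:V_0\to V_0$, $(A_0u,v)=a(u,v)$; $\Pi_j:V_h(\Omega_j')\to V_h$ and $\Pi_0:V_0\to V_h$ are the inclusions and $\Pi_j^*,\Pi_0^*$ their adjoints. *)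

theory Defs
  imports
    "HOL-Analysis.Analysis"
    "HOL-Probability.Essential_Supremum"
    "HOL-Library.Function_Algebras"
begin

section \<open>Euclidean space of variable dimension\<close>

text \<open>
  The bound to be stated must be uniform in the dimension \<open>d\<close>, so \<open>d\<close> has to be quantified inside
  the formula. Points of \<open>\<real>\<^sup>d\<close> are therefore the extensional functions on \<open>{..<d}\<close>,
  with the product topology and the (completed) product Lebesgue measure.
\<close>

type_synonym pt = "nat \<Rightarrow> real"
type_synonym fn = "pt \<Rightarrow> complex"
type_synonym form = "fn \<Rightarrow> fn \<Rightarrow> complex"

abbreviation Rd :: "nat \<Rightarrow> pt topology" where
  "Rd d \<equiv> powertop_real {..<d}"

definition leb :: "nat \<Rightarrow> pt measure" where
  "leb d = completion (Pi\<^sub>M {..<d} (\<lambda>_. lborel))"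

definition leb_on :: "nat \<Rightarrow> pt set \<Rightarrow> pt measure" where
  "leb_on d D = restrict_space (leb d) D"

definition bounded_Rd :: "nat \<Rightarrow> pt set \<Rightarrow> bool" where
  "bounded_Rd d D \<longleftrightarrow> D \<subseteq> topspace (Rd d) \<and> (\<exists>r. \<forall>x\<in>D. \<forall>i<d. \<bar>x i\<bar> \<le> r)"

text \<open>A pair \<open>(c, b)\<close> encodes the open half-space of all \<open>x\<close> with \<open>c \<bullet> x < b\<close>. A convex cell is a
  full-dimensional convex polytope, i.e. the closure of a nonempty bounded finite intersection of
  open half-spaces.\<close>

definition open_polyhedron :: "nat \<Rightarrow> (pt \<times> real) set \<Rightarrow> pt set" where
  "open_polyhedron d H = {x \<in> topspace (Rd d). \<forall>(c, b)\<in>H. (\<Sum>i<d. c i * x i) < b}"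

definition convex_cell :: "nat \<Rightarrow> pt set \<Rightarrow> bool" where
  "convex_cell d K \<longleftrightarrow> (\<exists>H. finite H \<and> open_polyhedron d H \<noteq> {} \<and>
     bounded_Rd d (open_polyhedron d H) \<and> K = Rd d closure_of (open_polyhedron d H))"

definition polyhedral_body :: "nat \<Rightarrow> pt set \<Rightarrow> bool" where
  "polyhedral_body d D \<longleftrightarrow> (\<exists>P. finite P \<and> P \<noteq> {} \<and> (\<forall>K\<in>P. convex_cell d K) \<and> D = \<Union>P)"

definition polyhedral_domain :: "nat \<Rightarrow> pt set \<Rightarrow> bool" where
  "polyhedral_domain d \<Omega> \<longleftrightarrow> connectedin (Rd d) \<Omega> \<and>
     (\<exists>D. polyhedral_body d D \<and> \<Omega> = Rd d interior_of D)"

text \<open>The elements of a partition need be neither convex nor conforming.\<close>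

definition partition_of :: "nat \<Rightarrow> pt set \<Rightarrow> pt set set \<Rightarrow> bool" where
  "partition_of d \<Omega> T \<longleftrightarrow> finite T \<and> (\<forall>\<tau>\<in>T. polyhedral_body d \<tau>) \<and>
     (\<forall>\<sigma>\<in>T. \<forall>\<tau>\<in>T. \<sigma> \<noteq> \<tau> \<longrightarrow> Rd d interior_of \<sigma> \<inter> Rd d interior_of \<tau> = {}) \<and>
     \<Union>T = Rd d closure_of \<Omega>"

definition mesh_regions :: "pt set set \<Rightarrow> pt set set" where
  "mesh_regions T = {\<Union>S | S. S \<subseteq> T}"

text \<open>Adding one layer to a set of elements: all elements touching it, possibly only in a vertex.\<close>

definition add_layer :: "pt set set \<Rightarrow> pt set set \<Rightarrow> pt set set" where
  "add_layer T S = {\<tau> \<in> T. \<tau> \<inter> \<Union>S \<noteq> {}}"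


section \<open>Complex function spaces and sesquilinear forms\<close>

definition cscale :: "complex \<Rightarrow> fn \<Rightarrow> fn" where
  "cscale c u = (\<lambda>x. c * u x)"

interpretation cfun: vector_space cscale
  by standard (auto simp: cscale_def fun_eq_iff algebra_simps)

text \<open>The restriction of \<open>u\<close> to \<open>D\<close>, extended by \<open>0\<close> so that functions on \<open>D\<close> form a vector space.\<close>

definition restr :: "pt set \<Rightarrow> fn \<Rightarrow> fn" where
  "restr D u = (\<lambda>x. if x \<in> D then u x else 0)"

definition finite_dim :: "fn set \<Rightarrow> bool" where
  "finite_dim X \<longleftrightarrow> (\<exists>B. finite B \<and> X = cfun.span B)"

text \<open>Forms are linear in the first and conjugate-linear in the second argument.\<close>

definition sesquilinear_on :: "fn set \<Rightarrow> form \<Rightarrow> bool" where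
  "sesquilinear_on X b \<longleftrightarrow> (\<forall>u\<in>X. \<forall>v\<in>X. \<forall>w\<in>X. \<forall>c.
     b (u + v) w = b u w + b v w \<and> b (cscale c u) w = c * b u w \<and>
     b w (u + v) = b w u + b w v \<and> b w (cscale c u) = cnj c * b w u)"

definition hermitian_on :: "fn set \<Rightarrow> form \<Rightarrow> bool" where
  "hermitian_on X b \<longleftrightarrow> (\<forall>u\<in>X. \<forall>v\<in>X. b u v = cnj (b v u))"

definition nonneg_form_on :: "fn set \<Rightarrow> form \<Rightarrow> bool" where
  "nonneg_form_on X b \<longleftrightarrow> sesquilinear_on X b \<and> hermitian_on X b \<and> (\<forall>u\<in>X. 0 \<le> Re (b u u))"

definition posdef_form_on :: "fn set \<Rightarrow> form \<Rightarrow> bool" where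
  "posdef_form_on X b \<longleftrightarrow> nonneg_form_on X b \<and> (\<forall>u\<in>X. u \<noteq> 0 \<longrightarrow> 0 < Re (b u u))"

text \<open>Positive definiteness when functions are identified almost everywhere.\<close>

definition posdef_form_AE :: "pt measure \<Rightarrow> fn set \<Rightarrow> form \<Rightarrow> bool" where
  "posdef_form_AE M X b \<longleftrightarrow> nonneg_form_on X b \<and>
     (\<forall>u\<in>X. Re (b u u) = 0 \<longleftrightarrow> (AE x in M. u x = 0))"

definition form_norm :: "form \<Rightarrow> fn \<Rightarrow> real" where
  "form_norm b u = sqrt (Re (b u u))"

definition hilbert_AE :: "pt measure \<Rightarrow> fn set \<Rightarrow> bool" where
  "hilbert_AE M X \<longleftrightarrow> cfun.subspace X \<and>
     (\<exists>b. posdef_form_AE M X b \<and>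
       (\<forall>U :: nat \<Rightarrow> fn. (\<forall>n. U n \<in> X) \<and>
            (\<forall>e>0. \<exists>n0. \<forall>m\<ge>n0. \<forall>n\<ge>n0. form_norm b (U m - U n) < e) \<longrightarrow>
          (\<exists>u\<in>X. (\<lambda>n. form_norm b (U n - u)) \<longlonglongrightarrow> 0)))"

definition L2 :: "pt measure \<Rightarrow> fn set" where
  "L2 M = {u \<in> borel_measurable M. integrable M (\<lambda>x. (cmod (u x))\<^sup>2)}"

definition Linf :: "pt measure \<Rightarrow> fn set" where
  "Linf M = {\<eta> \<in> borel_measurable M. esssup M (\<lambda>x. ereal (cmod (\<eta> x))) < \<infinity>}"

definition Linf_norm :: "pt measure \<Rightarrow> fn \<Rightarrow> real" where
  "Linf_norm M \<eta> = real_of_ereal (esssup M (\<lambda>x. ereal (cmod (\<eta> x))))"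

text \<open>The operator \<open>A\<close> on \<open>X\<close> with \<open>(A u, v) = b u v\<close> for all \<open>v \<in> X\<close>, and the adjoint
  \<open>T\<^sup>* : Y \<rightarrow> X\<close> of \<open>T : X \<rightarrow> Y\<close> (\<open>X, Y\<close> carry the same inner product \<open>ip\<close>).\<close>

definition form_operator :: "fn set \<Rightarrow> form \<Rightarrow> form \<Rightarrow> fn \<Rightarrow> fn" where
  "form_operator X ip b u = (THE w. w \<in> X \<and> (\<forall>v\<in>X. ip w v = b u v))"

definition adjoint_operator :: "fn set \<Rightarrow> form \<Rightarrow> (fn \<Rightarrow> fn) \<Rightarrow> fn \<Rightarrow> fn" where
  "adjoint_operator X ip T u = (THE w. w \<in> X \<and> (\<forall>v\<in>X. ip w v = ip u (T v)))"

definition eigenvalues_on :: "fn set \<Rightarrow> (fn \<Rightarrow> fn) \<Rightarrow> complex set" where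
  "eigenvalues_on X T = {\<mu>. \<exists>u\<in>X. u \<noteq> 0 \<and> T u = cscale \<mu> u}"

text \<open>Spectral condition number, i.e. largest over smallest modulus of an eigenvalue, and \<open>\<infinity>\<close> for a
  singular operator. On the trivial space it is \<open>0\<close>. For an operator that is self-adjoint and positive
  with respect to some inner product (here \<open>a(\<cdot>,\<cdot>)\<close>) this is \<open>\<lambda>\<^sub>m\<^sub>a\<^sub>x / \<lambda>\<^sub>m\<^sub>i\<^sub>n\<close>.\<close>

definition cond_number :: "fn set \<Rightarrow> (fn \<Rightarrow> fn) \<Rightarrow> ereal" where
  "cond_number X T =
     (if 0 \<in> eigenvalues_on X T then \<infinity>
      else (SUP \<mu>\<in>eigenvalues_on X T. ereal (cmod \<mu>)) / (INF \<mu>\<in>eigenvalues_on X T. ereal (cmod \<mu>)))"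


section \<open>The setting\<close>

text \<open>
  \<open>sol_space\<close> is \<open>V(\<Omega>)\<close>, \<open>fe_space\<close> is \<open>V\<^sub>h\<close>, \<open>ip\<close> the fixed inner product on \<open>V\<^sub>h\<close>.
  \<open>aform D\<close> is \<open>a(\<cdot>,\<cdot>)\<close> restricted to \<open>D\<close>; it acts on functions on \<open>D\<close>, and \<open>D\<close> ranges over
  the closed unions of elements. \<open>sform i\<close> is \<open>s\<^sub>i\<close>, acting on functions on the closure of
  \<open>\<Omega>\<^sub>i\<close>. \<open>layers i\<close> is the number of layers added to \<open>\<Omega>\<^sub>i\<close>. \<open>eval i j\<close> and \<open>efun i j\<close> are the
  eigenpairs of the local problems. Subdomains are indexed by \<open>{1..nsub}\<close>.
\<close>

record schwarz =
  sdim :: nat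
  domain_of :: "pt set"
  sol_space :: "fn set"
  fe_space :: "fn set"
  ip :: form
  aform :: "pt set \<Rightarrow> form"
  mesh :: "pt set set"
  nsub :: nat
  sub :: "nat \<Rightarrow> pt set"
  layers :: "nat \<Rightarrow> nat"
  cutoff :: "nat \<Rightarrow> pt \<Rightarrow> real"
  sform :: "nat \<Rightarrow> form"
  interp :: "fn \<Rightarrow> fn"
  threshold :: real
  eval :: "nat \<Rightarrow> nat \<Rightarrow> real"
  efun :: "nat \<Rightarrow> nat \<Rightarrow> fn"

definition cl :: "schwarz \<Rightarrow> pt set \<Rightarrow> pt set" where
  "cl P D = Rd (sdim P) closure_of D"

definition intr :: "schwarz \<Rightarrow> pt set \<Rightarrow> pt set" where
  "intr P D = Rd (sdim P) interior_of D"

definition a_on :: "schwarz \<Rightarrow> pt set \<Rightarrow> form" where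
  "a_on P D u v = aform P D (restr D u) (restr D v)"

definition a_full :: "schwarz \<Rightarrow> form" where
  "a_full P = a_on P (cl P (domain_of P))"

definition s_on :: "schwarz \<Rightarrow> nat \<Rightarrow> form" where
  "s_on P i u v = sform P i (restr (cl P (sub P i)) u) (restr (cl P (sub P i)) v)"

definition cut :: "schwarz \<Rightarrow> nat \<Rightarrow> fn \<Rightarrow> fn" where
  "cut P i v = (\<lambda>x. of_real (cutoff P i x) * v x)"

definition cut_products :: "schwarz \<Rightarrow> fn set" where
  "cut_products P = {cut P i v | i v. i \<in> {1..nsub P} \<and> v \<in> fe_space P}"

text \<open>The functions on which \<open>a\<close> is defined: besides \<open>V(\<Omega>)\<close> and \<open>V\<^sub>h\<close> also the
  products of cutoff functions and functions of \<open>V\<^sub>h\<close>.\<close>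

definition a_space :: "schwarz \<Rightarrow> fn set" where
  "a_space P = cfun.span (sol_space P \<union> fe_space P \<union> cut_products P)"

text \<open>The functions on the closure of \<open>\<Omega>\<^sub>i\<close> on which \<open>s\<^sub>i\<close> is defined: besides the
  restrictions of \<open>V\<^sub>h\<close> (take \<open>\<eta> = 1\<close>) also those of \<open>V(\<Omega>)\<close> and the products \<open>\<eta> v\<close>.\<close>

definition s_space :: "schwarz \<Rightarrow> nat \<Rightarrow> fn set" where
  "s_space P i = cfun.span
     (restr (cl P (sub P i)) ` (sol_space P \<union>
        {\<eta> * v | \<eta> v. \<eta> \<in> Linf (leb_on (sdim P) (cl P (sub P i))) \<and> v \<in> fe_space P}))"

definition fe_restricted :: "schwarz \<Rightarrow> nat \<Rightarrow> fn set" where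
  "fe_restricted P i = restr (cl P (sub P i)) ` fe_space P"

definition sub_ext :: "schwarz \<Rightarrow> nat \<Rightarrow> pt set" where
  "sub_ext P i = intr P (\<Union>((add_layer (mesh P) ^^ layers P i) {\<tau> \<in> mesh P. \<tau> \<subseteq> cl P (sub P i)}))"

definition nbrs :: "schwarz \<Rightarrow> nat \<Rightarrow> nat set" where
  "nbrs P i = {j \<in> {1..nsub P}. sub_ext P j \<inter> sub_ext P i \<noteq> {}}"

definition max_nbrs :: "schwarz \<Rightarrow> nat" where
  "max_nbrs P = Max ((\<lambda>i. card (nbrs P i)) ` {1..nsub P})"

text \<open>Supports are closed, so supports contained in an open extended subdomain mean, as usual for
  finite element functions, contained in its closure.\<close>

definition fe_local :: "schwarz \<Rightarrow> nat \<Rightarrow> fn set" where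
  "fe_local P i = {u \<in> fe_space P. cl P {x. u x \<noteq> 0} \<subseteq> cl P (sub_ext P i)}"

text \<open>In \<open>forms_setting\<close>, the last condition but one says that the boundary of a region does not
  contribute to \<open>a(\<cdot>,\<cdot>)\<close> restricted to it. Functions of \<open>V\<^sub>h\<close> are
  extended by zero outside the closure of \<open>\<Omega>\<close>.\<close>

definition geometry_setting :: "schwarz \<Rightarrow> bool" where
  "geometry_setting P \<longleftrightarrow>
     1 \<le> sdim P \<and> polyhedral_domain (sdim P) (domain_of P) \<and>
     partition_of (sdim P) (domain_of P) (mesh P) \<and>
     1 \<le> nsub P \<and>
     (\<forall>i\<in>{1..nsub P}. \<exists>S\<subseteq>mesh P. S \<noteq> {} \<and> sub P i = intr P (\<Union>S)) \<and>
     (\<forall>i\<in>{1..nsub P}. \<forall>j\<in>{1..nsub P}. i \<noteq> j \<longrightarrow> sub P i \<inter> sub P j = {}) \<and>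
     cl P (domain_of P) = (\<Union>i\<in>{1..nsub P}. cl P (sub P i)) \<and>
     (\<forall>i\<in>{1..nsub P}. 1 \<le> layers P i)"

definition cutoff_setting :: "schwarz \<Rightarrow> bool" where
  "cutoff_setting P \<longleftrightarrow>
     (\<forall>x\<in>cl P (domain_of P). (\<Sum>i\<in>{1..nsub P}. cutoff P i x) = 1) \<and>
     (\<forall>i\<in>{1..nsub P}.
        cutoff P i \<in> borel_measurable (leb_on (sdim P) (domain_of P)) \<and>
        (\<forall>x\<in>cl P (domain_of P). 0 \<le> cutoff P i x \<and> cutoff P i x \<le> 1) \<and>
        cl P {x \<in> cl P (domain_of P). cutoff P i x \<noteq> 0} \<subseteq> cl P (sub_ext P i))"

definition forms_setting :: "schwarz \<Rightarrow> bool" where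
  "forms_setting P \<longleftrightarrow>
     sol_space P \<subseteq> L2 (leb_on (sdim P) (domain_of P)) \<and>
     hilbert_AE (leb_on (sdim P) (domain_of P)) (sol_space P) \<and>
     fe_space P \<subseteq> L2 (leb_on (sdim P) (domain_of P)) \<and>
     finite_dim (fe_space P) \<and>
     (\<forall>u\<in>fe_space P. \<forall>x. x \<notin> cl P (domain_of P) \<longrightarrow> u x = 0) \<and>
     posdef_form_on (fe_space P) (ip P) \<and>
     posdef_form_on (fe_space P) (a_full P) \<and>
     posdef_form_AE (leb_on (sdim P) (domain_of P)) (sol_space P) (a_full P) \<and>
     (\<forall>D\<in>mesh_regions (mesh P). nonneg_form_on (a_space P) (a_on P D)) \<and>
     (\<forall>D\<in>mesh_regions (mesh P). \<forall>u\<in>a_space P. \<forall>v\<in>a_space P.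
        (\<forall>x\<in>intr P D. u x = 0) \<longrightarrow> a_on P D u v = 0) \<and>
     (\<forall>D\<in>mesh_regions (mesh P). \<forall>E\<in>mesh_regions (mesh P). intr P D \<inter> intr P E = {} \<longrightarrow>
        (\<forall>u\<in>a_space P. \<forall>v\<in>a_space P. a_on P (D \<union> E) u v = a_on P D u v + a_on P E u v))"

definition assumption1 :: "real \<Rightarrow> schwarz \<Rightarrow> bool" where
  "assumption1 Ct P \<longleftrightarrow> 0 < Ct \<and>
     (\<forall>i\<in>{1..nsub P}.
        nonneg_form_on (s_space P i) (sform P i) \<and>
        posdef_form_on (fe_restricted P i) (sform P i) \<and>
        (\<forall>j\<in>nbrs P i. \<forall>u\<in>fe_space P.
           Re (a_on P (cl P (sub P i)) (cut P j u) (cut P j u))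
             \<le> Ct * (Re (a_on P (cl P (sub P i)) u u) + Re (s_on P i u u))) \<and>
        (\<forall>\<eta>\<in>Linf (leb_on (sdim P) (cl P (sub P i))). \<forall>u\<in>fe_space P.
           form_norm (s_on P i) (\<eta> * u)
             \<le> Linf_norm (leb_on (sdim P) (cl P (sub P i))) \<eta> * form_norm (s_on P i) u))"

text \<open>The interpolation operator acts on classes of functions that agree almost everywhere.\<close>

definition assumption2 :: "real \<Rightarrow> real \<Rightarrow> schwarz \<Rightarrow> bool" where
  "assumption2 CIa CIs P \<longleftrightarrow>
     (\<forall>u\<in>L2 (leb_on (sdim P) (domain_of P)). interp P u \<in> fe_space P \<and>
        (\<forall>c. interp P (cscale c u) = cscale c (interp P u)) \<and>
        (\<forall>v\<in>L2 (leb_on (sdim P) (domain_of P)).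
           interp P (u + v) = interp P u + interp P v \<and>
           ((AE x in leb_on (sdim P) (domain_of P). u x = v x) \<longrightarrow> interp P u = interp P v))) \<and>
     (\<forall>v\<in>fe_space P. interp P v = v \<and> (\<forall>i\<in>{1..nsub P}. interp P (cut P i v) \<in> fe_local P i)) \<and>
     (\<forall>u\<in>sol_space P \<union> cut_products P.
        (\<forall>\<tau>\<in>mesh P. Re (a_on P \<tau> (interp P u) (interp P u)) \<le> CIa * Re (a_on P \<tau> u u)) \<and>
        (\<Sum>l\<in>{1..nsub P}. (form_norm (s_on P l) (interp P u))\<^sup>2)
          \<le> CIs * (\<Sum>l\<in>{1..nsub P}. (form_norm (s_on P l) u)\<^sup>2))"


section \<open>Coarse space and preconditioner\<close>

definition nloc :: "schwarz \<Rightarrow> nat \<Rightarrow> nat" where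
  "nloc P i = cfun.dim (fe_restricted P i)"

definition local_eigenproblems :: "schwarz \<Rightarrow> bool" where
  "local_eigenproblems P \<longleftrightarrow> 1 < threshold P \<and>
     (\<forall>i\<in>{1..nsub P}.
        (\<forall>j\<in>{1..nloc P i}. efun P i j \<in> fe_restricted P i \<and> 0 < eval P i j \<and>
           (\<forall>w\<in>fe_restricted P i.
              sform P i (efun P i j) w
                = of_real (eval P i j) * aform P (cl P (sub P i)) (efun P i j) w)) \<and>
        (\<forall>j\<in>{1..nloc P i}. \<forall>k\<in>{1..nloc P i}.
           (j \<le> k \<longrightarrow> eval P i k \<le> eval P i j) \<and>
           sform P i (efun P i j) (efun P i k) = (if j = k then 1 else 0) \<and>
           (j \<noteq> k \<longrightarrow> aform P (cl P (sub P i)) (efun P i j) (efun P i k) = 0)))"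

definition nlarge :: "schwarz \<Rightarrow> nat \<Rightarrow> nat" where
  "nlarge P i = card {j \<in> {1..nloc P i}. threshold P \<le> eval P i j}"

definition aux_space :: "schwarz \<Rightarrow> nat \<Rightarrow> fn set" where
  "aux_space P i = cfun.span (efun P i ` {1..nlarge P i})"

definition tilde_space :: "schwarz \<Rightarrow> fn set" where
  "tilde_space P = {v \<in> fe_space P. \<forall>i\<in>{1..nsub P}. \<forall>w\<in>aux_space P i.
     sform P i (restr (cl P (sub P i)) v) w = 0}"

definition coarse_space :: "schwarz \<Rightarrow> fn set" where
  "coarse_space P = {u \<in> fe_space P. \<forall>v\<in>tilde_space P. a_full P u v = 0}"

definition A_h :: "schwarz \<Rightarrow> fn \<Rightarrow> fn" where
  "A_h P = form_operator (fe_space P) (ip P) (a_full P)"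

definition A_loc :: "schwarz \<Rightarrow> nat \<Rightarrow> fn \<Rightarrow> fn" where
  "A_loc P j = form_operator (fe_local P j) (ip P) (a_on P (cl P (sub_ext P j)))"

definition A_coarse :: "schwarz \<Rightarrow> fn \<Rightarrow> fn" where
  "A_coarse P = form_operator (coarse_space P) (ip P) (a_full P)"

text \<open>The prolongations \<open>\<Pi>\<^sub>j\<close> and \<open>\<Pi>\<^sub>0\<close> are inclusions into \<open>V\<^sub>h\<close>, that is \<^term>\<open>id\<close>.\<close>

definition B_inv :: "schwarz \<Rightarrow> fn \<Rightarrow> fn" where
  "B_inv P u =
     (\<Sum>j\<in>{1..nsub P}.
        id (inv_into (fe_local P j) (A_loc P j) (adjoint_operator (fe_local P j) (ip P) id u))) +
     id (inv_into (coarse_space P) (A_coarse P) (adjoint_operator (coarse_space P) (ip P) id u))"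

definition schwarz_setting :: "schwarz \<Rightarrow> bool" where
  "schwarz_setting P \<longleftrightarrow>
     geometry_setting P \<and> cutoff_setting P \<and> forms_setting P \<and> local_eigenproblems P"

end

theory Submission
  imports Defs
begin

text \<open>
  \<open>B\<^sup>-\<^sup>1 A\<^sub>h\<close> is the sum of the \<open>a\<close>-orthogonal projections onto the local spaces and \<open>V\<^sub>0\<close>.
  Local spaces whose extended subdomains do not meet are \<open>a\<close>-orthogonal and each subdomain has at most
  \<open>M\<close> neighbours, so the eigenvalues are at most \<open>M + 1\<close>. For the lower bound split
  \<open>u = u\<^sub>0 + w\<close> along \<open>V\<^sub>0\<close> and its \<open>a\<close>-orthogonal complement and decompose
  \<open>w = \<Sum>\<^sub>j I\<^sub>h(\<theta>\<^sub>j w)\<close>. Since \<open>w\<close> is \<open>s\<^sub>i\<close>-orthogonal to all eigenfunctions with eigenvalue at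
  least \<open>\<Lambda>\<close>, \<open>s\<^sub>i(w, w) \<le> \<Lambda> a\<^sub>i(w, w)\<close>, so the two assumptions bound the energy of the pieces
  by a multiple of \<open>M (1 + \<Lambda>) a(w, w)\<close>. By Cauchy-Schwarz this stable splitting bounds the
  eigenvalues from below.
\<close>

section \<open>Hermitian forms on function spaces\<close>

text \<open>Eta-expanded functions would otherwise be turned into abstractions by the simplifier.\<close>

declare plus_fun_apply [simp del] zero_fun_apply [simp del] minus_apply [simp del]
  uminus_apply [simp del]

text \<open>The coarse part costs only a constant 1: \<open>coarse_space P\<close> is by definition
  the \<open>a\<close>-orthogonal complement of \<open>tilde_space P\<close>, so the energies of the
  two parts of u add up to that of u. The whole analysis moves to the fine part, from which the
  eigenfunctions violating a bound of s_i by \<Lambda> times a_i have been removed by definition.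
  Independence of the number of subdomains comes from restricting double sums over pairs (i, j) to
  neighbours, and this happens twice: for products of local projections, and for the cutoff
  functions that are felt on one subdomain. The obstacle is topological. Neighbours are defined by
  open extended subdomains, whereas supports lie only in their closures. Unions of elements are
  closures of their interiors, so an open region that avoids the interior of such a union avoids the
  union as well. The spectrum is estimated one eigenvector at a time, by testing the eigenvalue
  equation in the energy form, rather than through the spectral theory of self-adjoint
  operators.\<close>

lemma sum_fun_apply: "(\<Sum>j\<in>J. f j) x = (\<Sum>j\<in>J. f j x)" for f :: "'i \<Rightarrow> 'a \<Rightarrow> 'b::comm_monoid_add"
  by (induction J rule: infinite_finite_induct) (auto simp: plus_fun_apply zero_fun_apply)

lemma finite_dim_subspace:
  assumes "finite_dim X" "cfun.subspace Y" "Y \<subseteq> X"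
  shows "finite_dim Y"
proof -
  obtain B where B: "finite B" "X = cfun.span B"
    using assms(1) by (auto simp: finite_dim_def)
  obtain B' where B': "B' \<subseteq> Y" "cfun.independent B'" "Y \<subseteq> cfun.span B'"
    by (rule cfun.basis_exists)
  have "finite B'"
    using cfun.independent_span_bound[OF B(1) B'(2)] B'(1) assms(3) B(2) by auto
  moreover have "Y = cfun.span B'"
    using B' assms(2) by (metis cfun.span_minimal subset_antisym)
  ultimately show ?thesis by (auto simp: finite_dim_def)
qed

text \<open>The energy restricted to a region is in general only semidefinite, because a nonzero
  function may vanish there. The algebra of forms is therefore kept apart from arguments that use
  definiteness.\<close>

locale psd_form =
  fixes X :: "fn set" and b :: form
  assumes subspace: "cfun.subspace X" and nonneg: "nonneg_form_on X b"
begin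

lemmas mem_simps = cfun.subspace_add[OF subspace] cfun.subspace_scale[OF subspace]
  cfun.subspace_diff[OF subspace] cfun.subspace_0[OF subspace]

lemma add_left: "u \<in> X \<Longrightarrow> v \<in> X \<Longrightarrow> w \<in> X \<Longrightarrow> b (u + v) w = b u w + b v w"
  and add_right: "u \<in> X \<Longrightarrow> v \<in> X \<Longrightarrow> w \<in> X \<Longrightarrow> b w (u + v) = b w u + b w v"
  and scale_left: "u \<in> X \<Longrightarrow> w \<in> X \<Longrightarrow> b (cscale c u) w = c * b u w"
  and scale_right: "u \<in> X \<Longrightarrow> w \<in> X \<Longrightarrow> b w (cscale c u) = cnj c * b w u"
  and herm: "u \<in> X \<Longrightarrow> v \<in> X \<Longrightarrow> b u v = cnj (b v u)"
  and nonneg_Re: "u \<in> X \<Longrightarrow> 0 \<le> Re (b u u)"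
  using nonneg unfolding nonneg_form_on_def sesquilinear_on_def hermitian_on_def by blast+

lemma zero_left: "w \<in> X \<Longrightarrow> b 0 w = 0"
  using add_left[of 0 0 w] mem_simps by simp

lemma zero_right: "w \<in> X \<Longrightarrow> b w 0 = 0"
  using add_right[of 0 0 w] mem_simps by simp

lemma diff_left: "u \<in> X \<Longrightarrow> v \<in> X \<Longrightarrow> w \<in> X \<Longrightarrow> b (u - v) w = b u w - b v w"
  using add_left[of "u - v" v w] mem_simps by simp

lemma sum_mem: "(\<And>j. j \<in> J \<Longrightarrow> f j \<in> X) \<Longrightarrow> (\<Sum>j\<in>J. f j) \<in> X"
  by (rule cfun.subspace_sum[OF subspace])

lemma sum_left:
  assumes "\<And>j. j \<in> J \<Longrightarrow> f j \<in> X" "w \<in> X"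
  shows "b (\<Sum>j\<in>J. f j) w = (\<Sum>j\<in>J. b (f j) w)"
  using assms(1)
proof (induction J rule: infinite_finite_induct)
  case (insert i J)
  have m: "(\<Sum>j\<in>J. f j) \<in> X" "f i \<in> X"
    by (rule sum_mem, rule insert.prems, erule insertI2) (rule insert.prems, rule insertI1)
  have "b (\<Sum>j\<in>insert i J. f j) w = b (f i) w + b (\<Sum>j\<in>J. f j) w"
    by (simp only: add_left[OF m(2,1) assms(2)] sum.insert[OF insert.hyps])
  also have "b (\<Sum>j\<in>J. f j) w = (\<Sum>j\<in>J. b (f j) w)"
    by (rule insert.IH, rule insert.prems, erule insertI2)
  finally show ?case by (simp only: sum.insert[OF insert.hyps])
qed (simp_all only: sum.empty sum.infinite zero_left[OF assms(2)] not_False_eq_True)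

lemma sum_right:
  assumes "\<And>j. j \<in> J \<Longrightarrow> f j \<in> X" "w \<in> X"
  shows "b w (\<Sum>j\<in>J. f j) = (\<Sum>j\<in>J. b w (f j))"
proof -
  have "(\<Sum>j\<in>J. f j) \<in> X"
    by (rule sum_mem, rule assms(1))
  then have "b w (\<Sum>j\<in>J. f j) = cnj (\<Sum>j\<in>J. b (f j) w)"
    by (simp only: herm[OF assms(2)] sum_left[OF assms])
  also have "\<dots> = (\<Sum>j\<in>J. b w (f j))"
    unfolding cnj_sum using herm[OF assms(2)] assms(1) by (intro sum.cong) simp_all
  finally show ?thesis .
qed

lemma Im_self: "u \<in> X \<Longrightarrow> Im (b u u) = 0"
  using arg_cong[OF herm, of u u Im] by simp

lemma norm_sq: "u \<in> X \<Longrightarrow> (form_norm b u)\<^sup>2 = Re (b u u)"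
  by (simp add: form_norm_def nonneg_Re)

lemma norm_nonneg: "u \<in> X \<Longrightarrow> 0 \<le> form_norm b u"
  by (simp add: form_norm_def nonneg_Re)

lemma norm_add_sq:
  assumes "u \<in> X" "v \<in> X"
  shows "Re (b (u + v) (u + v)) = Re (b u u) + 2 * Re (b u v) + Re (b v v)"
proof -
  have "Re (b v u) = Re (b u v)" using arg_cong[OF herm[OF assms], of Re] by simp
  then show ?thesis using mem_simps(1)[OF assms] assms by (simp add: add_left add_right)
qed

lemma subset_psd:
  assumes "cfun.subspace Y" "Y \<subseteq> X"
  shows "psd_form Y b"
proof -
  note Y = subsetD[OF assms(2)]
  have "sesquilinear_on Y b"
    unfolding sesquilinear_on_def
    by (intro ballI allI conjI) (simp_all only: Y add_left add_right scale_left scale_right)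
  moreover have "hermitian_on Y b"
    unfolding hermitian_on_def by (intro ballI herm Y)
  moreover have "\<forall>u\<in>Y. 0 \<le> Re (b u u)" by (intro ballI nonneg_Re Y)
  ultimately show ?thesis
    using assms(1) unfolding psd_form_def nonneg_form_on_def by (intro conjI)
qed

end

locale pd_form = psd_form +
  assumes pos: "u \<in> X \<Longrightarrow> u \<noteq> 0 \<Longrightarrow> 0 < Re (b u u)"
begin

lemma subset_pd: "cfun.subspace Y \<Longrightarrow> Y \<subseteq> X \<Longrightarrow> pd_form Y b"
  unfolding pd_form_def pd_form_axioms_def by (intro conjI allI impI subset_psd pos) blast+

lemma Re_le_norms:
  assumes "u \<in> X" "v \<in> X"
  shows "Re (b u v) \<le> form_norm b u * form_norm b v"
proof (cases "v = 0")
  case True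
  then show ?thesis using assms by (simp add: zero_right form_norm_def)
next
  case False
  \<comment> \<open>The minimiser of the energy of u - t v over real t. Only the real part of
    \<open>b u v\<close> is estimated, so a real multiplier suffices.\<close>
  define t where "t = Re (b u v) / Re (b v v)"
  define w where "w = cscale (of_real (- t)) v"
  have p: "0 < Re (b v v)" using pos[OF assms(2) False] .
  have w: "w \<in> X" unfolding w_def by (rule mem_simps(2)[OF assms(2)])
  have "0 \<le> Re (b (u + w) (u + w))" by (rule nonneg_Re[OF mem_simps(1)[OF assms(1) w]])
  also have "\<dots> = Re (b u u) + 2 * Re (b u w) + Re (b w w)" by (rule norm_add_sq[OF assms(1) w])
  also have "b u w = of_real (- t) * b u v"
    unfolding w_def by (simp only: scale_right[OF assms(2,1)] complex_cnj_complex_of_real)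
  also have "b w w = of_real (- t) * (of_real (- t) * b v v)"
    using scale_left[OF assms(2) w] scale_right[OF assms(2,2)]
    by (simp only: w_def complex_cnj_complex_of_real)
  also have "Re (b u u) + 2 * Re (of_real (- t) * b u v) + Re (of_real (- t) * (of_real (- t) * b v v))
      = Re (b u u) - 2 * t * Re (b u v) + t * t * Re (b v v)"
    by simp
  also have "\<dots> = Re (b u u) - (Re (b u v))\<^sup>2 / Re (b v v)"
    using p by (simp add: t_def field_simps power2_eq_square)
  finally have "(Re (b u v))\<^sup>2 \<le> Re (b u u) * Re (b v v)"
    using p by (simp add: field_simps)
  then have "\<bar>Re (b u v)\<bar> \<le> sqrt (Re (b u u) * Re (b v v))"
    using real_le_rsqrt by fastforce
  then show ?thesis by (simp add: form_norm_def real_sqrt_mult)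
qed

lemma norm_triangle:
  assumes "u \<in> X" "v \<in> X"
  shows "form_norm b (u + v) \<le> form_norm b u + form_norm b v"
proof -
  have "(form_norm b (u + v))\<^sup>2 \<le> (form_norm b u + form_norm b v)\<^sup>2"
    using norm_add_sq[OF assms] Re_le_norms[OF assms]
    by (simp add: norm_sq[OF mem_simps(1)[OF assms]] norm_sq[OF assms(1)] norm_sq[OF assms(2)]
        power2_sum)
  then show ?thesis
    by (rule power2_le_imp_le) (intro add_nonneg_nonneg norm_nonneg assms)
qed

lemma norm_scale: "u \<in> X \<Longrightarrow> form_norm b (cscale c u) = cmod c * form_norm b u"
proof -
  assume u: "u \<in> X"
  have "b (cscale c u) (cscale c u) = c * cnj c * b u u"
    by (simp add: scale_left[OF u mem_simps(2)[OF u]] scale_right[OF u u])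
  also have "c * cnj c = of_real ((cmod c)\<^sup>2)" by (rule complex_norm_square[symmetric])
  finally have "b (cscale c u) (cscale c u) = of_real ((cmod c)\<^sup>2) * b u u" .
  then show ?thesis by (simp add: form_norm_def real_sqrt_mult)
qed

lemma eqI_form:
  assumes "u \<in> X" "v \<in> X" "\<And>w. w \<in> X \<Longrightarrow> b u w = b v w"
  shows "u = v"
proof (rule ccontr)
  assume "u \<noteq> v"
  moreover have "b (u - v) (u - v) = 0"
    by (simp only: diff_left assms mem_simps diff_self)
  ultimately show False using pos[OF mem_simps(3)[OF assms(1,2)]] by simp
qed

end

lemma pd_form_iff: "pd_form X b \<longleftrightarrow> cfun.subspace X \<and> posdef_form_on X b"
  by (auto simp: pd_form_def psd_form_def pd_form_axioms_def posdef_form_on_def)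

text \<open>Makes definiteness of \<open>a\<close> available for a restricted form that agrees with
  \<open>a\<close> on a local space.\<close>

lemma pd_form_cong:
  assumes "pd_form X b" "\<And>u v. u \<in> X \<Longrightarrow> v \<in> X \<Longrightarrow> b' u v = b u v"
  shows "pd_form X b'"
proof -
  interpret pd_form X b by fact
  have "sesquilinear_on X b'"
    unfolding sesquilinear_on_def
    by (intro ballI allI conjI)
       (simp_all only: assms(2) mem_simps add_left add_right scale_left scale_right)
  moreover have "hermitian_on X b'"
    unfolding hermitian_on_def by (intro ballI) (simp only: assms(2), rule herm)
  ultimately show ?thesis
    using subspace
    by (simp add: pd_form_iff posdef_form_on_def nonneg_form_on_def assms(2) nonneg_Re pos)
qed

section \<open>Riesz representation and the operators that it makes well defined\<close>

definition antilinear_on :: "fn set \<Rightarrow> (fn \<Rightarrow> complex) \<Rightarrow> bool" where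
  "antilinear_on X f \<longleftrightarrow>
     (\<forall>u\<in>X. \<forall>v\<in>X. f (u + v) = f u + f v) \<and> (\<forall>c. \<forall>u\<in>X. f (cscale c u) = cnj c * f u)"

lemma (in psd_form) antilinear: "u \<in> X \<Longrightarrow> Y \<subseteq> X \<Longrightarrow> antilinear_on Y (b u)"
  by (simp add: antilinear_on_def add_right scale_right subset_iff)

lemma antilinear_on_subset: "antilinear_on X f \<Longrightarrow> Y \<subseteq> X \<Longrightarrow> antilinear_on Y f"
  unfolding antilinear_on_def by blast

text \<open>Gram-Schmidt in disguise: the induction hypothesis is used once to project the new
  generator \<open>x\<close> onto the old span, leaving an orthogonal direction \<open>e\<close>,
  and once to represent \<open>f\<close> on the old span. A multiple of \<open>e\<close> then
  repairs the value of \<open>f\<close> in the new direction.\<close>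

lemma riesz_span:
  assumes "finite B" "pd_form (cfun.span B) b" "antilinear_on (cfun.span B) f"
  shows "\<exists>u\<in>cfun.span B. \<forall>v\<in>cfun.span B. b u v = f v"
  using assms
proof (induction B arbitrary: f rule: finite_induct)
  case empty
  interpret pd_form "cfun.span {}" b by fact
  have "f (cscale 0 0) = cnj 0 * f 0"
    using empty.prems(2) by (auto simp: antilinear_on_def)
  then have "f 0 = 0" by simp
  then show ?case using zero_left by auto
next
  case (insert x B)
  interpret pd_form "cfun.span (insert x B)" b by fact
  have sub: "cfun.span B \<subseteq> cfun.span (insert x B)" by (simp add: cfun.span_mono subset_insertI)
  have pdB: "pd_form (cfun.span B) b"
    using subset_pd[OF cfun.subspace_span sub] .
  interpret B: pd_form "cfun.span B" b by fact
  show ?case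
  proof (cases "x \<in> cfun.span B")
    case True
    then have "cfun.span (insert x B) = cfun.span B" by (rule cfun.span_redundant)
    then show ?thesis
      using insert.IH[OF pdB antilinear_on_subset[OF insert.prems(2) sub]] by (simp only:)
  next
    case False
    have x: "x \<in> cfun.span (insert x B)" by (simp add: cfun.span_base)
    obtain p where p: "p \<in> cfun.span B" "\<And>v. v \<in> cfun.span B \<Longrightarrow> b p v = b x v"
      using insert.IH[OF pdB antilinear[OF x sub]] by blast
    obtain q where q: "q \<in> cfun.span B" "\<And>v. v \<in> cfun.span B \<Longrightarrow> b q v = f v"
      using insert.IH[OF pdB antilinear_on_subset[OF insert.prems(2) sub]] by blast
    define e where "e = x - p"
    have e: "e \<in> cfun.span (insert x B)"
      using x p(1) sub mem_simps by (auto simp: e_def)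
    have "e \<noteq> 0" using False p(1) by (auto simp: e_def)
    then have ee: "b e e \<noteq> 0" using pos[OF e] by auto
    have e_orth: "b e v = 0" if "v \<in> cfun.span B" for v
      using that x p sub by (simp add: e_def diff_left subset_iff)
    \<comment> \<open>\<open>q\<close> already represents \<open>f\<close> on the span of
      \<open>B\<close> and is orthogonal to \<open>e\<close>, so only the value at \<open>e\<close>
      remains to be matched.\<close>
    define c where "c = f e / b e e"
    let ?u = "q + cscale c e"
    have u: "?u \<in> cfun.span (insert x B)" using q(1) sub e mem_simps by blast
    have "b ?u v = f v" if v: "v \<in> cfun.span (insert x B)" for v
    proof -
      obtain k where "v - cscale k x \<in> cfun.span B"
        using v cfun.span_breakdown_eq by blast
      then have "v - cscale k x + cscale k p \<in> cfun.span B"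
        using B.mem_simps(1) B.mem_simps(2)[OF p(1)] by blast
      then have r: "v - cscale k e \<in> cfun.span B" (is "?r \<in> _")
        by (simp add: e_def cfun.scale_right_diff_distrib diff_diff_eq2 diff_add_eq)
      have r': "?r \<in> cfun.span (insert x B)" using r sub by blast
      have ke: "cscale k e \<in> cfun.span (insert x B)" using e mem_simps by blast
      have qX: "q \<in> cfun.span (insert x B)" using q sub by blast
      have qe: "b q e = 0" using herm[OF qX e] e_orth[OF q(1)] by simp
      have v_eq: "?r + cscale k e = v" by simp
      have "b ?u v = b ?u ?r + cnj k * b ?u e"
        using add_right[OF r' ke u] scale_right[OF e u] by (simp only: v_eq)
      also have "b ?u ?r = f ?r"
        using add_left[OF qX mem_simps(2)[OF e] r'] scale_left[OF e r'] e_orth[OF r] q(2)[OF r]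
        by simp
      also have "b ?u e = f e"
        using add_left[OF qX mem_simps(2)[OF e] e] scale_left[OF e e] qe ee by (simp add: c_def)
      also have "f ?r + cnj k * f e = f v"
      proof -
        have "f (?r + cscale k e) = f ?r + f (cscale k e)" "f (cscale k e) = cnj k * f e"
          using insert.prems(2) r' ke e unfolding antilinear_on_def by blast+
        then show ?thesis by (simp only: v_eq)
      qed
      finally show ?thesis .
    qed
    then show ?thesis using u by blast
  qed
qed

lemma riesz:
  assumes "finite_dim X" "pd_form X b" "antilinear_on X f"
  obtains u where "u \<in> X" "\<And>v. v \<in> X \<Longrightarrow> b u v = f v"
  using assms riesz_span unfolding finite_dim_def by metis

text \<open>Justifies the definite description: Riesz gives existence, definiteness of
  \<open>g\<close> gives uniqueness.\<close>

lemma form_operator_props: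
  assumes "finite_dim X" "pd_form X g" "antilinear_on X (b u)"
  shows "form_operator X g b u \<in> X"
    and "v \<in> X \<Longrightarrow> g (form_operator X g b u) v = b u v"
proof -
  interpret pd_form X g by fact
  obtain w where w: "w \<in> X" "\<And>v. v \<in> X \<Longrightarrow> g w v = b u v"
    using riesz[OF assms] by blast
  have "form_operator X g b u \<in> X \<and> (\<forall>v\<in>X. g (form_operator X g b u) v = b u v)"
    unfolding form_operator_def
  proof (rule theI[of _ w])
    show "w \<in> X \<and> (\<forall>v\<in>X. g w v = b u v)" using w by blast
    show "w' = w" if "w' \<in> X \<and> (\<forall>v\<in>X. g w' v = b u v)" for w'
      by (rule eqI_form) (use that w in simp_all)
  qed
  then show "form_operator X g b u \<in> X" "v \<in> X \<Longrightarrow> g (form_operator X g b u) v = b u v"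
    by auto
qed

text \<open>Riesz for \<open>b\<close> makes the operator surjective, and that is all
  \<open>inv_into\<close> requires: whichever preimage it picks solves the variational
  problem.\<close>

lemma inv_form_operator:
  assumes "finite_dim X" "pd_form X g" "pd_form X b" "w \<in> X"
  defines "p \<equiv> inv_into X (form_operator X g b) w"
  shows "p \<in> X" and "v \<in> X \<Longrightarrow> b p v = g w v"
proof -
  interpret g: pd_form X g by fact
  interpret b: pd_form X b by fact
  obtain u where u: "u \<in> X" "\<And>v. v \<in> X \<Longrightarrow> b u v = g w v"
    using riesz[OF assms(1,3) g.antilinear[OF assms(4) subset_refl]] by blast
  note fo = form_operator_props[where b = b, OF assms(1,2) b.antilinear[OF _ subset_refl]]
  have "form_operator X g b u = w"
    by (rule g.eqI_form) (use fo[OF u(1)] u(2) assms(4) in simp_all)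
  then have w: "w \<in> form_operator X g b ` X" using u(1) by blast
  show p: "p \<in> X" unfolding p_def using inv_into_into[OF w] .
  have "form_operator X g b p = w" unfolding p_def using f_inv_into_f[OF w] .
  then show "v \<in> X \<Longrightarrow> b p v = g w v" using fo(2)[OF p] by simp
qed

lemma adjoint_inclusion:
  assumes "finite_dim X" "pd_form X g" "antilinear_on X (g u)"
  shows "adjoint_operator X g id u \<in> X"
    and "v \<in> X \<Longrightarrow> g (adjoint_operator X g id u) v = g u v"
  using form_operator_props[where b = g and u = u, OF assms]
  by (simp_all add: adjoint_operator_def form_operator_def)

text \<open>The inner product \<open>g\<close> cancels along the chain a(p, v) = g(adjoint of A u,
  v) = g(A u, v) = a(u, v), so the result is the \<open>a\<close>-orthogonal projection of
  \<open>u\<close>, whatever \<open>g\<close> is.\<close>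

lemma local_solve_projection:
  assumes V: "finite_dim V" "pd_form V g" "pd_form V a"
    and X: "cfun.subspace X" "X \<subseteq> V"
    and a': "\<And>u v. u \<in> X \<Longrightarrow> v \<in> X \<Longrightarrow> a' u v = a u v"
    and u: "u \<in> V"
  defines "p \<equiv> inv_into X (form_operator X g a')
     (adjoint_operator X g id (form_operator V g a u))"
  shows "p \<in> X" and "v \<in> X \<Longrightarrow> a p v = a u v"
proof -
  interpret g: pd_form V g by fact
  interpret a: pd_form V a by fact
  have fX: "finite_dim X" using finite_dim_subspace[OF V(1) X] .
  have gX: "pd_form X g" using g.subset_pd X by blast
  have a'X: "pd_form X a'" by (rule pd_form_cong[OF a.subset_pd[OF X]]) (rule a')
  note A = form_operator_props[where b = a and u = u, OF V(1,2) a.antilinear[OF u subset_refl]]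
  note adj = adjoint_inclusion[where u = "form_operator V g a u", OF fX gX g.antilinear[OF A(1) X(2)]]
  note inv = inv_form_operator[OF fX gX a'X adj(1), folded p_def]
  show p: "p \<in> X" by (rule inv(1))
  show "v \<in> X \<Longrightarrow> a p v = a u v"
    using inv(2)[of v] adj(2)[of v] A(2)[of v] a'[OF p, of v] X(2) by auto
qed

section \<open>Additive Schwarz operators and generalized eigenproblems\<close>

text \<open>With s the sum of the projections, only neighbouring pairs contribute to b(s, s), and
  the arithmetic-geometric mean inequality bounds it by M times the sum of the energies b(p_j, p_j).
  By the projection property that sum equals Re b(u, s), so Cauchy-Schwarz applies and one factor,
  the norm of s, cancels.\<close>

lemma (in pd_form) sum_projections_norm_le:
  fixes M :: real
  assumes J: "finite J" and u: "u \<in> X" and p: "\<And>j. j \<in> J \<Longrightarrow> p j \<in> X"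
    and proj: "\<And>j. j \<in> J \<Longrightarrow> b (p j) (p j) = b u (p j)"
    and N: "\<And>i. i \<in> J \<Longrightarrow> N i \<subseteq> J" "\<And>i. i \<in> J \<Longrightarrow> card (N i) \<le> M"
    and sym: "\<And>i j. i \<in> J \<Longrightarrow> j \<in> J \<Longrightarrow> j \<in> N i \<longleftrightarrow> i \<in> N j"
    and orth: "\<And>i j. i \<in> J \<Longrightarrow> j \<in> J \<Longrightarrow> j \<notin> N i \<Longrightarrow> b (p i) (p j) = 0"
    and M: "0 \<le> M"
  shows "form_norm b (\<Sum>j\<in>J. p j) \<le> M * form_norm b u"
proof -
  define s where "s = (\<Sum>j\<in>J. p j)"
  define n where "n j = form_norm b (p j)" for j
  define S where "S = (\<Sum>j\<in>J. (n j)\<^sup>2)"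
  have s: "s \<in> X" unfolding s_def by (rule sum_mem) (rule p)
  have row: "(\<Sum>i\<in>J. \<Sum>j\<in>N i. (n i)\<^sup>2) \<le> M * S"
  proof -
    have "(\<Sum>i\<in>J. \<Sum>j\<in>N i. (n i)\<^sup>2) = (\<Sum>i\<in>J. card (N i) * (n i)\<^sup>2)" by simp
    also have "\<dots> \<le> (\<Sum>i\<in>J. M * (n i)\<^sup>2)"
      by (rule sum_mono) (rule mult_right_mono, use N(2) in auto)
    finally show ?thesis by (simp add: S_def sum_distrib_left)
  qed
  have restr: "(\<Sum>j\<in>N i. f j) = (\<Sum>j\<in>J. if j \<in> N i then f j else 0)"
    if "i \<in> J" for i and f :: "'a \<Rightarrow> real"
    using sum.inter_restrict[OF J, of f "N i"] N(1)[OF that] by (simp add: Int_absorb1)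
  \<comment> \<open>Symmetry of the neighbour relation turns column sums into row sums, so a single
    cardinality bound serves both.\<close>
  have "(\<Sum>i\<in>J. \<Sum>j\<in>N i. (n j)\<^sup>2) = (\<Sum>i\<in>J. \<Sum>j\<in>J. if j \<in> N i then (n j)\<^sup>2 else 0)"
    by (rule sum.cong[OF refl]) (rule restr)
  also have "\<dots> = (\<Sum>j\<in>J. \<Sum>i\<in>J. if j \<in> N i then (n j)\<^sup>2 else 0)" by (rule sum.swap)
  also have "\<dots> = (\<Sum>j\<in>J. \<Sum>i\<in>J. if i \<in> N j then (n j)\<^sup>2 else 0)"
    using sym by (intro sum.cong refl) simp
  also have "\<dots> = (\<Sum>j\<in>J. \<Sum>i\<in>N j. (n j)\<^sup>2)"
    by (rule sum.cong[OF refl]) (rule restr[symmetric])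
  finally have column: "(\<Sum>i\<in>J. \<Sum>j\<in>N i. (n j)\<^sup>2) \<le> M * S" using row by simp
  have pair: "Re (b (p i) (p j)) \<le> ((n i)\<^sup>2 + (n j)\<^sup>2) / 2" if "i \<in> J" "j \<in> J" for i j
  proof -
    have "Re (b (p i) (p j)) \<le> n i * n j"
      unfolding n_def by (rule Re_le_norms[OF p[OF that(1)] p[OF that(2)]])
    then show ?thesis using sum_squares_bound[of "n i" "n j"] by simp
  qed
  have "b s s = (\<Sum>i\<in>J. b (p i) s)"
    unfolding s_def by (rule sum_left[OF p s[unfolded s_def]])
  also have "\<dots> = (\<Sum>i\<in>J. \<Sum>j\<in>J. b (p i) (p j))"
    by (rule sum.cong[OF refl]) (unfold s_def, rule sum_right[OF p p])
  also have "Re \<dots> = (\<Sum>i\<in>J. \<Sum>j\<in>J. Re (b (p i) (p j)))" by simp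
  also have "\<dots> = (\<Sum>i\<in>J. \<Sum>j\<in>N i. Re (b (p i) (p j)))"
  proof (rule sum.cong[OF refl])
    fix i assume i: "i \<in> J"
    have "Re (b (p i) (p j)) = 0" if "j \<in> J - N i" for j
      using orth[OF i, of j] that by simp
    then show "(\<Sum>j\<in>J. Re (b (p i) (p j))) = (\<Sum>j\<in>N i. Re (b (p i) (p j)))"
      using sum.mono_neutral_left[OF J N(1)[OF i]] by metis
  qed
  also have "\<dots> \<le> (\<Sum>i\<in>J. \<Sum>j\<in>N i. ((n i)\<^sup>2 + (n j)\<^sup>2) / 2)"
    by (intro sum_mono pair) (use N(1) in auto)
  also have "\<dots> = ((\<Sum>i\<in>J. \<Sum>j\<in>N i. (n i)\<^sup>2) + (\<Sum>i\<in>J. \<Sum>j\<in>N i. (n j)\<^sup>2)) / 2"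
    by (simp only: sum.distrib sum_divide_distrib[symmetric])
  also have "\<dots> \<le> M * S" using row column by simp
  finally have ss: "Re (b s s) \<le> M * S" .
  have "S = (\<Sum>j\<in>J. Re (b u (p j)))"
    unfolding S_def n_def
    by (rule sum.cong[OF refl]) (simp only: norm_sq[OF p] proj)
  also have "\<dots> = Re (b u s)" by (simp add: s_def sum_right[OF p u])
  also have "\<dots> \<le> form_norm b u * form_norm b s" by (rule Re_le_norms[OF u s])
  finally have "(form_norm b s)\<^sup>2 \<le> M * (form_norm b u * form_norm b s)"
    using ss M norm_sq[OF s] mult_left_mono[of S _ M] by fastforce
  then have "form_norm b s * form_norm b s \<le> (M * form_norm b u) * form_norm b s"
    by (simp add: power2_eq_square mult_ac)
  then show ?thesis
    unfolding s_def[symmetric]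
    using norm_nonneg[OF s] norm_nonneg[OF u] M mult_right_le_imp_le
    by (cases "form_norm b s = 0") (auto simp: less_le)
qed

text \<open>Lions' lemma. Pairing u with its splitting gives b(u, u) as the sum of b(p_j, d_j).
  Cauchy-Schwarz separates the d_j, controlled by stability, from the p_j, whose total energy is
  exactly Re b(u, sum of p_j).\<close>

lemma (in pd_form) stable_splitting_lower_bound:
  assumes u: "u \<in> X" and d: "\<And>j. j \<in> J \<Longrightarrow> d j \<in> X" and p: "\<And>j. j \<in> J \<Longrightarrow> p j \<in> X"
    and sum_d: "(\<Sum>j\<in>J. d j) = u"
    and proj: "\<And>j. j \<in> J \<Longrightarrow> b (p j) (d j) = b u (d j)"
      "\<And>j. j \<in> J \<Longrightarrow> b (p j) (p j) = b u (p j)"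
    and stable: "(\<Sum>j\<in>J. Re (b (d j) (d j))) \<le> c * Re (b u u)" and c: "0 \<le> c"
  shows "Re (b u u) \<le> c * Re (b u (\<Sum>j\<in>J. p j))"
proof -
  define A T where "A = Re (b u u)" and "T = Re (b u (\<Sum>j\<in>J. p j))"
  have "b u (\<Sum>j\<in>J. p j) = (\<Sum>j\<in>J. b u (p j))" by (rule sum_right[OF p u])
  then have "T = (\<Sum>j\<in>J. Re (b u (p j)))" by (simp add: T_def)
  also have "\<dots> = (\<Sum>j\<in>J. (form_norm b (p j))\<^sup>2)"
    by (rule sum.cong[OF refl]) (simp only: norm_sq[OF p] proj(2))
  finally have T: "T = (\<Sum>j\<in>J. (form_norm b (p j))\<^sup>2)" .
  have "A = Re (b u (\<Sum>j\<in>J. d j))" by (simp only: A_def sum_d)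
  also have "b u (\<Sum>j\<in>J. d j) = (\<Sum>j\<in>J. b u (d j))" by (rule sum_right[OF d u])
  also have "\<dots> = (\<Sum>j\<in>J. b (p j) (d j))" by (rule sum.cong[OF refl]) (simp only: proj(1))
  also have "Re \<dots> = (\<Sum>j\<in>J. Re (b (p j) (d j)))" by simp
  also have "\<dots> \<le> (\<Sum>j\<in>J. form_norm b (p j) * form_norm b (d j))"
    by (rule sum_mono) (rule Re_le_norms[OF p d])
  finally have "A\<^sup>2 \<le> (\<Sum>j\<in>J. form_norm b (p j) * form_norm b (d j))\<^sup>2"
    using nonneg_Re[OF u] by (simp add: A_def power_mono)
  also have "\<dots> \<le> T * (\<Sum>j\<in>J. (form_norm b (d j))\<^sup>2)"
    unfolding T by (rule Cauchy_Schwarz_ineq_sum)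
  also have "(\<Sum>j\<in>J. (form_norm b (d j))\<^sup>2) = (\<Sum>j\<in>J. Re (b (d j) (d j)))"
    by (rule sum.cong[OF refl]) (rule norm_sq[OF d])
  also have "T * \<dots> \<le> T * (c * A)"
    using stable unfolding A_def by (rule mult_left_mono) (simp add: T sum_nonneg)
  finally have "A * A \<le> (c * T) * A" by (simp add: power2_eq_square mult_ac)
  moreover have "0 \<le> c * T" using c by (simp add: T sum_nonneg)
  moreover have "0 \<le> A" using nonneg_Re[OF u] by (simp add: A_def)
  ultimately have "A \<le> c * T" using mult_right_le_imp_le by (cases "A = 0") (auto simp: less_le)
  then show ?thesis by (simp add: A_def T_def)
qed

text \<open>Enlarging the numerator and then lowering the denominator bounds the quotient. If there
  are no eigenvalues, the supremum is -\<infinity> and the infimum \<infinity>, and both estimates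
  persist.\<close>

lemma cond_number_le:
  assumes "\<And>u \<mu>. u \<in> X \<Longrightarrow> u \<noteq> 0 \<Longrightarrow> T u = cscale \<mu> u \<Longrightarrow> 1 / c \<le> cmod \<mu> \<and> cmod \<mu> \<le> K"
    and c: "0 < c" and K: "0 < K"
  shows "cond_number X T \<le> ereal (K * c)"
proof -
  let ?E = "eigenvalues_on X T"
  have E: "1 / c \<le> cmod \<mu> \<and> cmod \<mu> \<le> K" if "\<mu> \<in> ?E" for \<mu>
    using that assms(1) by (auto simp: eigenvalues_on_def)
  have "0 \<notin> ?E" using E[of 0] c by auto
  then have *: "cond_number X T = (SUP \<mu>\<in>?E. ereal (cmod \<mu>)) / (INF \<mu>\<in>?E. ereal (cmod \<mu>))"
    by (simp add: cond_number_def)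
  have sup: "(SUP \<mu>\<in>?E. ereal (cmod \<mu>)) \<le> ereal K"
    using E by (intro SUP_least) simp
  have inf: "ereal (1 / c) \<le> (INF \<mu>\<in>?E. ereal (cmod \<mu>))"
    using E by (intro INF_greatest) simp
  have inf_pos: "0 < (INF \<mu>\<in>?E. ereal (cmod \<mu>))"
    using inf c by (meson ereal_less(2) less_le_trans zero_less_divide_1_iff)
  have "cond_number X T \<le> ereal K / (INF \<mu>\<in>?E. ereal (cmod \<mu>))"
    unfolding * using sup inf_pos by (rule ereal_divide_right_mono)
  also have "\<dots> \<le> ereal K / ereal (1 / c)"
    using inf K c by (intro ereal_divide_left_mono) (auto simp: inf_pos ereal_zero_less_0_iff)
  also have "\<dots> = ereal (K * c)" using c by simp
  finally show ?thesis .
qed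

section \<open>Orthonormal expansions and generalized eigenproblems\<close>

lemma (in pd_form) orthogonal_independent:
  assumes "finite A" "A \<subseteq> X" "0 \<notin> A"
    and orth: "\<And>x y. x \<in> A \<Longrightarrow> y \<in> A \<Longrightarrow> x \<noteq> y \<Longrightarrow> b x y = 0"
  shows "cfun.independent A"
proof (rule cfun.independent_if_scalars_zero[OF assms(1)])
  fix f y assume 0: "(\<Sum>x\<in>A. cscale (f x) x) = 0" and y: "y \<in> A"
  note A = subsetD[OF assms(2)]
  have "b (\<Sum>x\<in>A. cscale (f x) x) y = (\<Sum>x\<in>A. b (cscale (f x) x) y)"
    by (rule sum_left[OF mem_simps(2)[OF A] A[OF y]])
  also have "\<dots> = (\<Sum>x\<in>A. if x = y then f y * b y y else 0)"
    by (rule sum.cong[OF refl]) (simp add: scale_left[OF A A[OF y]] orth[OF _ y])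
  also have "\<dots> = f y * b y y" using assms(1) y by simp
  finally have "f y * b y y = 0" by (simp only: 0 zero_left[OF A[OF y]])
  moreover have "b y y \<noteq> 0" using pos[OF A[OF y]] y assms(3) by fastforce
  ultimately show "f y = 0" by simp
qed

text \<open>Spanning comes from counting: a nonzero remainder is orthogonal to all
  \<open>e j\<close>, so it would give n + 1 independent vectors in a space of dimension n.\<close>

lemma (in pd_form) orthonormal_expansion:
  assumes fd: "finite_dim X" and n: "n = cfun.dim X"
    and e: "\<And>j. j \<in> {1..n} \<Longrightarrow> e j \<in> X"
    and on: "\<And>j k. j \<in> {1..n} \<Longrightarrow> k \<in> {1..n} \<Longrightarrow> b (e j) (e k) = (if j = k then 1 else 0)"
    and v: "v \<in> X"
  shows "v = (\<Sum>j\<in>{1..n}. cscale (b v (e j)) (e j))"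
proof (rule ccontr)
  define w where "w = v - (\<Sum>j\<in>{1..n}. cscale (b v (e j)) (e j))"
  assume "\<not> ?thesis"
  then have "w \<noteq> 0" by (simp add: w_def)
  have sX: "(\<Sum>j\<in>{1..n}. cscale (b v (e j)) (e j)) \<in> X"
    by (rule sum_mem) (rule mem_simps(2)[OF e])
  have w: "w \<in> X" unfolding w_def by (rule mem_simps(3)[OF v sX])
  have we: "b w (e k) = 0" if k: "k \<in> {1..n}" for k
  proof -
    have "b (\<Sum>j\<in>{1..n}. cscale (b v (e j)) (e j)) (e k)
        = (\<Sum>j\<in>{1..n}. b (cscale (b v (e j)) (e j)) (e k))"
      by (rule sum_left[OF mem_simps(2)[OF e] e[OF k]])
    also have "\<dots> = (\<Sum>j\<in>{1..n}. if j = k then b v (e k) else 0)"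
      by (rule sum.cong[OF refl]) (simp add: scale_left[OF e e[OF k]] on[OF _ k])
    also have "\<dots> = b v (e k)" using k by simp
    finally show ?thesis unfolding w_def diff_left[OF v sX e[OF k]] by simp
  qed
  have inj: "inj_on e {1..n}"
    by (rule inj_onI) (metis on zero_neq_one)
  have ee: "b (e k) (e k) = 1" if "k \<in> {1..n}" for k using on[OF that that] by simp
  have w_notin: "w \<notin> e ` {1..n}" using we ee by force
  let ?A = "insert w (e ` {1..n})"
  have "0 \<notin> e ` {1..n}"
    using ee zero_left[OF mem_simps(4)] by force
  moreover have "b x y = 0" if "x \<in> ?A" "y \<in> ?A" "x \<noteq> y" for x y
  proof -
    have "b (e k) w = 0" if "k \<in> {1..n}" for k
      using herm[OF e[OF that] w] we[OF that] by simp
    then show ?thesis using that we on by auto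
  qed
  ultimately have ind: "cfun.independent ?A"
    using \<open>w \<noteq> 0\<close> w e by (intro orthogonal_independent) auto
  obtain B where B: "B \<subseteq> X" "cfun.independent B" "X \<subseteq> cfun.span B" "card B = n"
    unfolding n by (rule cfun.basis_exists)
  obtain B' where "finite B'" "X = cfun.span B'" using fd by (auto simp: finite_dim_def)
  then have "finite B" using cfun.independent_span_bound[OF _ B(2)] B(1) by blast
  then have "card ?A \<le> n"
    using cfun.independent_span_bound[OF \<open>finite B\<close> ind] B(3,4) w e by blast
  moreover have "card ?A = Suc n" using w_notin inj by (simp add: card_image)
  ultimately show False by simp
qed

text \<open>In the eigenbasis s(v, v) is the sum of |c_j|^2 and a(v, v) the sum of |c_j|^2 / l_j.
  Coefficients with l_j at least \<Lambda> vanish, and for the others each term of the first sum is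
  at most \<Lambda> times that of the second.\<close>

lemma spectral_gap:
  fixes l :: "nat \<Rightarrow> real"
  assumes s: "pd_form X s" and a: "psd_form X a" and fd: "finite_dim X" and n: "n = cfun.dim X"
    and e: "\<And>j. j \<in> {1..n} \<Longrightarrow> e j \<in> X"
    and on: "\<And>j k. j \<in> {1..n} \<Longrightarrow> k \<in> {1..n} \<Longrightarrow> s (e j) (e k) = (if j = k then 1 else 0)"
    and eig: "\<And>j w. j \<in> {1..n} \<Longrightarrow> w \<in> X \<Longrightarrow> s (e j) w = of_real (l j) * a (e j) w"
    and l: "\<And>j. j \<in> {1..n} \<Longrightarrow> 0 < l j"
    and v: "v \<in> X" and small: "\<And>j. j \<in> {1..n} \<Longrightarrow> \<Lambda> \<le> l j \<Longrightarrow> s v (e j) = 0"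
  shows "Re (s v v) \<le> \<Lambda> * Re (a v v)"
proof -
  interpret s: pd_form X s by fact
  interpret a: psd_form X a by fact
  define c where "c j = s v (e j)" for j
  have v_eq: "v = (\<Sum>j\<in>{1..n}. cscale (c j) (e j))"
    unfolding c_def by (rule s.orthonormal_expansion[OF fd n e on v])
  note ce = s.mem_simps(2)[OF e]
  have ev: "s (e j) v = cnj (c j)" if "j \<in> {1..n}" for j
    unfolding c_def by (rule s.herm[OF e[OF that] v])
  have "s v v = (\<Sum>j\<in>{1..n}. s (cscale (c j) (e j)) v)"
    using s.sum_left[of "{1..n}" "\<lambda>j. cscale (c j) (e j)", OF ce v] by (simp only: v_eq[symmetric])
  also have "\<dots> = (\<Sum>j\<in>{1..n}. of_real ((cmod (c j))\<^sup>2))"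
    by (rule sum.cong[OF refl]) (simp only: s.scale_left[OF e v] ev complex_norm_square)
  finally have sv: "Re (s v v) = (\<Sum>j\<in>{1..n}. (cmod (c j))\<^sup>2)" by simp
  have "a v v = (\<Sum>j\<in>{1..n}. a (cscale (c j) (e j)) v)"
    using a.sum_left[of "{1..n}" "\<lambda>j. cscale (c j) (e j)", OF ce v] by (simp only: v_eq[symmetric])
  also have "\<dots> = (\<Sum>j\<in>{1..n}. of_real ((cmod (c j))\<^sup>2 / l j))"
  proof (rule sum.cong[OF refl])
    fix j assume j: "j \<in> {1..n}"
    have "a (e j) v = cnj (c j) / of_real (l j)"
      using eig[OF j v] ev[OF j] l[OF j] by (simp add: field_simps)
    then have "a (cscale (c j) (e j)) v = c j * cnj (c j) / of_real (l j)"
      by (simp add: a.scale_left[OF e[OF j] v])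
    then show "a (cscale (c j) (e j)) v = of_real ((cmod (c j))\<^sup>2 / l j)"
      by (simp only: complex_norm_square[symmetric] of_real_divide)
  qed
  finally have av: "Re (a v v) = (\<Sum>j\<in>{1..n}. (cmod (c j))\<^sup>2 / l j)" by simp
  have "(cmod (c j))\<^sup>2 \<le> \<Lambda> * ((cmod (c j))\<^sup>2 / l j)" if j: "j \<in> {1..n}" for j
  proof (cases "\<Lambda> \<le> l j")
    case True
    then show ?thesis using small[OF j] by (simp add: c_def)
  next
    case False
    then have "l j * (cmod (c j))\<^sup>2 \<le> \<Lambda> * (cmod (c j))\<^sup>2" by (intro mult_right_mono) auto
    then show ?thesis using l[OF j] by (simp add: field_simps)
  qed
  then show ?thesis unfolding sv av sum_distrib_left by (rule sum_mono)
qed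

section \<open>Regular closed regions of the partition\<close>

lemma openin_open_polyhedron:
  assumes "finite H"
  shows "openin (Rd d) (open_polyhedron d H)"
proof -
  have 1: "openin (Rd d) {x \<in> topspace (Rd d). (\<Sum>i<d. c i * x i) < b}" for c b
  proof -
    have "continuous_map (Rd d) euclideanreal (\<lambda>x. \<Sum>i<d. c i * x i)"
      by (intro continuous_map_sum continuous_map_real_mult_left continuous_map_product_projection)
        auto
    from openin_continuous_map_preimage[OF this, of "{..<b}"] show ?thesis by simp
  qed
  have "open_polyhedron d H = topspace (Rd d) \<inter>
      \<Inter>((\<lambda>(c, b). {x \<in> topspace (Rd d). (\<Sum>i<d. c i * x i) < b}) ` H)"
    by (auto simp: open_polyhedron_def)
  also have "openin (Rd d) \<dots>"
  \<comment> \<open>An empty intersection is \<open>UNIV\<close>, which is not open in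
    \<open>Rd d\<close>, whose points are extensional functions only.\<close>
  proof (cases "H = {}")
    case False
    then show ?thesis
      using assms 1 by (intro openin_Int openin_topspace openin_Inter) auto
  qed (simp only: image_empty Inter_empty Int_UNIV_right openin_topspace)
  finally show ?thesis .
qed

text \<open>Regular closed sets have no lower-dimensional parts sticking out, so disjointness can be
  tested on interiors. Finite unions inherit the property, which covers all mesh regions.\<close>

definition regular_closed :: "'a topology \<Rightarrow> 'a set \<Rightarrow> bool" where
  "regular_closed X K \<longleftrightarrow> K = X closure_of (X interior_of K)"

lemma regular_closed_closedin: "regular_closed X K \<Longrightarrow> closedin X K"
  unfolding regular_closed_def by (metis closedin_closure_of)

lemma regular_closed_closure_of_open:
  assumes "openin X U"
  shows "regular_closed X (X closure_of U)"
proof -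
  have "U \<subseteq> X interior_of (X closure_of U)"
    using assms by (simp add: closure_of_subset interior_of_maximal openin_subset)
  then have "X closure_of U \<subseteq> X closure_of (X interior_of (X closure_of U))"
    by (rule closure_of_mono)
  moreover have "X closure_of (X interior_of (X closure_of U)) \<subseteq> X closure_of U"
    by (simp add: closure_of_minimal interior_of_subset)
  ultimately show ?thesis by (simp add: regular_closed_def)
qed

lemma regular_closed_Union:
  assumes "finite F" "\<And>K. K \<in> F \<Longrightarrow> regular_closed X K"
  shows "regular_closed X (\<Union>F)"
proof -
  have "K \<subseteq> X closure_of (X interior_of (\<Union>F))" if "K \<in> F" for K
  proof -
    have "X closure_of (X interior_of K) \<subseteq> X closure_of (X interior_of (\<Union>F))"
      using that by (intro closure_of_mono interior_of_mono) auto
    then show ?thesis using assms(2)[OF that] by (simp add: regular_closed_def)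
  qed
  moreover have "X closure_of (X interior_of (\<Union>F)) \<subseteq> \<Union>F"
    using assms by (intro closure_of_minimal interior_of_subset closedin_Union)
      (auto intro: regular_closed_closedin)
  ultimately show ?thesis unfolding regular_closed_def by blast
qed

text \<open>An open set that meets the closure of a set meets the set itself.\<close>

lemma disjoint_regular_closed:
  assumes "openin X U" "regular_closed X K" "U \<inter> X interior_of K = {}"
  shows "U \<inter> K = {}"
  using assms openin_Int_closure_of_eq_empty unfolding regular_closed_def by metis

lemma convex_cell_regular:
  assumes "convex_cell d K"
  shows "regular_closed (Rd d) K" "Rd d interior_of K \<noteq> {}"
proof -
  obtain H where H: "finite H" "open_polyhedron d H \<noteq> {}" "K = Rd d closure_of (open_polyhedron d H)"
    using assms unfolding convex_cell_def by blast
  note op = openin_open_polyhedron[OF H(1), of d]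
  show "regular_closed (Rd d) K" using regular_closed_closure_of_open[OF op] H(3) by simp
  have "open_polyhedron d H \<subseteq> Rd d interior_of K"
    unfolding H(3) by (intro interior_of_maximal closure_of_subset openin_subset op)
  then show "Rd d interior_of K \<noteq> {}" using H(2) by blast
qed

lemma polyhedral_body_regular:
  assumes "polyhedral_body d D"
  shows "regular_closed (Rd d) D" "Rd d interior_of D \<noteq> {}"
proof -
  obtain F where F: "finite F" "F \<noteq> {}" "\<forall>K\<in>F. convex_cell d K" "D = \<Union>F"
    using assms unfolding polyhedral_body_def by blast
  show "regular_closed (Rd d) D"
    using regular_closed_Union[OF F(1)] convex_cell_regular(1) F(3,4) by simp
  obtain K where "K \<in> F" using F(2) by blast
  then have "Rd d interior_of K \<subseteq> Rd d interior_of D" unfolding F(4) by (intro interior_of_mono) auto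
  then show "Rd d interior_of D \<noteq> {}" using convex_cell_regular(2) F(3) \<open>K \<in> F\<close> by blast
qed

text \<open>Layers grow because a nonempty element touches itself; an empty element would be dropped
  by \<open>add_layer\<close>.\<close>

lemma funpow_add_layer:
  assumes "S \<subseteq> T" "{} \<notin> T"
  shows "S \<subseteq> (add_layer T ^^ n) S \<and> (add_layer T ^^ n) S \<subseteq> T"
proof (induction n)
  case (Suc n)
  have "S' \<subseteq> add_layer T S'" if "S' \<subseteq> T" for S'
  proof
    fix \<tau> assume "\<tau> \<in> S'"
    then show "\<tau> \<in> add_layer T S'" using that assms(2) by (cases "\<tau> = {}") (auto simp: add_layer_def)
  qed
  moreover have "add_layer T S' \<subseteq> T" for S' by (auto simp: add_layer_def)
  ultimately show ?case using Suc unfolding funpow.simps o_apply by blast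
qed (use assms in simp)

section \<open>Square integrable functions and restrictions\<close>

lemma L2_add:
  assumes "u \<in> L2 M" "v \<in> L2 M"
  shows "u + v \<in> L2 M"
proof -
  have m: "u \<in> borel_measurable M" "v \<in> borel_measurable M"
    and i: "integrable M (\<lambda>x. (cmod (u x))\<^sup>2)" "integrable M (\<lambda>x. (cmod (v x))\<^sup>2)"
    using assms by (auto simp: L2_def)
  have le: "(cmod (u x + v x))\<^sup>2 \<le> 2 * ((cmod (u x))\<^sup>2 + (cmod (v x))\<^sup>2)" for x
  proof -
    have "(cmod (u x + v x))\<^sup>2 \<le> (cmod (u x) + cmod (v x))\<^sup>2"
      by (intro power_mono norm_triangle_ineq) simp
    then show ?thesis using sum_squares_bound[of "cmod (u x)" "cmod (v x)"]
      by (simp add: power2_sum)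
  qed
  have "integrable M (\<lambda>x. (cmod (u x + v x))\<^sup>2)"
  proof (rule Bochner_Integration.integrable_bound)
    show "integrable M (\<lambda>x. 2 * ((cmod (u x))\<^sup>2 + (cmod (v x))\<^sup>2))"
      by (intro integrable_mult_right Bochner_Integration.integrable_add i)
    show "(\<lambda>x. (cmod (u x + v x))\<^sup>2) \<in> borel_measurable M"
      using m by measurable
    show "AE x in M. norm ((cmod (u x + v x))\<^sup>2)
        \<le> norm (2 * ((cmod (u x))\<^sup>2 + (cmod (v x))\<^sup>2))"
      using le by (intro AE_I2) simp
  qed
  then show ?thesis using m by (simp add: L2_def plus_fun_def)
qed

lemma L2_sum: "finite J \<Longrightarrow> (\<And>j. j \<in> J \<Longrightarrow> f j \<in> L2 M) \<Longrightarrow> (\<Sum>j\<in>J. f j) \<in> L2 M"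
proof (induction J rule: finite_induct)
  case empty
  show ?case by (simp add: L2_def zero_fun_def)
next
  case (insert x F)
  have "f x + (\<Sum>j\<in>F. f j) \<in> L2 M"
    by (rule L2_add, rule insert.prems, rule insertI1, rule insert.IH, rule insert.prems,
        erule insertI2)
  then show ?case by (simp only: sum.insert[OF insert.hyps])
qed

lemma restr_add: "restr D (u + v) = restr D u + restr D v"
  and restr_scale: "restr D (cscale c u) = cscale c (restr D u)"
  and restr_zero: "restr D 0 = 0"
  by (auto simp: restr_def cscale_def plus_fun_apply zero_fun_apply fun_eq_iff)

lemma restr_image_subspace:
  assumes "cfun.subspace Y"
  shows "cfun.subspace (restr D ` Y)"
  unfolding cfun.subspace_def
proof (intro conjI ballI allI)
  show "0 \<in> restr D ` Y" using cfun.subspace_0[OF assms] restr_zero[of D] by (intro image_eqI) simp_all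
  fix u v c assume "u \<in> restr D ` Y"
  then obtain u' where u: "u' \<in> Y" "u = restr D u'" by (elim imageE)
  show "cscale c u \<in> restr D ` Y"
    unfolding u(2) restr_scale[symmetric] by (rule imageI[OF cfun.subspace_scale[OF assms u(1)]])
  assume "v \<in> restr D ` Y"
  then obtain v' where v: "v' \<in> Y" "v = restr D v'" by (elim imageE)
  show "u + v \<in> restr D ` Y"
    unfolding u(2) v(2) restr_add[symmetric]
    by (rule imageI[OF cfun.subspace_add[OF assms u(1) v(1)]])
qed

lemma restr_image_finite_dim:
  assumes "finite_dim Y"
  shows "finite_dim (restr D ` Y)"
proof -
  obtain B where B: "finite B" "Y = cfun.span B" using assms by (auto simp: finite_dim_def)
  have "cfun.subspace {u. restr D u \<in> cfun.span (restr D ` B)}"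
    unfolding cfun.subspace_def
    by (simp add: restr_add restr_scale restr_zero cfun.span_zero cfun.span_add cfun.span_scale)
  moreover have "B \<subseteq> {u. restr D u \<in> cfun.span (restr D ` B)}"
    by (auto intro: cfun.span_base)
  ultimately have "cfun.span B \<subseteq> {u. restr D u \<in> cfun.span (restr D ` B)}"
    by (intro cfun.span_minimal)
  then have sub: "restr D ` Y \<subseteq> cfun.span (restr D ` B)" unfolding B(2) by blast
  have "finite_dim (cfun.span (restr D ` B))" using B(1) by (auto simp: finite_dim_def)
  moreover have "cfun.subspace (restr D ` Y)"
    by (rule restr_image_subspace) (simp add: B(2))
  ultimately show ?thesis using sub by (rule finite_dim_subspace)
qed

section \<open>The two-level method\<close>

locale schwarz_problem =
  fixes P :: schwarz and Ct CIa CIs :: real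
  assumes setting: "schwarz_setting P"
    and a1: "assumption1 Ct P" and a2: "assumption2 CIa CIs P"
begin

abbreviation "X \<equiv> Rd (sdim P)"
abbreviation "V \<equiv> fe_space P"
abbreviation "a \<equiv> a_full P"
abbreviation "I \<equiv> {1..nsub P}"
abbreviation "clD i \<equiv> cl P (sub P i)"

section \<open>Elements, subdomains and additivity of the energy\<close>

lemma geometry: "geometry_setting P" and cutoffs: "cutoff_setting P"
  and forms: "forms_setting P" and eigen: "local_eigenproblems P"
  using setting by (simp_all add: schwarz_setting_def)

lemma partition: "partition_of (sdim P) (domain_of P) (mesh P)"
  using geometry by (simp add: geometry_setting_def)

lemma sub_eq: "\<forall>i\<in>I. \<exists>S\<subseteq>mesh P. S \<noteq> {} \<and> sub P i = intr P (\<Union>S)"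
  and sub_disjoint: "\<forall>i\<in>I. \<forall>j\<in>I. i \<noteq> j \<longrightarrow> sub P i \<inter> sub P j = {}"
  and sub_cover: "cl P (domain_of P) = (\<Union>i\<in>I. clD i)"
  using geometry unfolding geometry_setting_def by - (elim conjE, assumption)+

lemma finite_mesh: "finite (mesh P)"
  and Union_mesh: "\<Union>(mesh P) = cl P (domain_of P)"
  and mesh_disjoint: "\<sigma> \<in> mesh P \<Longrightarrow> \<tau> \<in> mesh P \<Longrightarrow> \<sigma> \<noteq> \<tau> \<Longrightarrow> intr P \<sigma> \<inter> intr P \<tau> = {}"
  and mesh_body: "\<tau> \<in> mesh P \<Longrightarrow> polyhedral_body (sdim P) \<tau>"
  using partition unfolding partition_of_def cl_def intr_def by simp_all

lemma regular_mesh_region: "S \<subseteq> mesh P \<Longrightarrow> regular_closed X (\<Union>S)"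
  using regular_closed_Union[of S X] polyhedral_body_regular(1) mesh_body finite_mesh
  by (meson finite_subset subsetD)

lemma cl_intr: "S \<subseteq> mesh P \<Longrightarrow> cl P (intr P (\<Union>S)) = \<Union>S"
  using regular_mesh_region by (simp add: regular_closed_def cl_def intr_def)

lemma intr_mesh_nonempty: "\<tau> \<in> mesh P \<Longrightarrow> intr P \<tau> \<noteq> {}"
  unfolding intr_def using polyhedral_body_regular(2) mesh_body by blast

lemma intr_subset: "intr P D \<subseteq> D"
  by (simp add: intr_def interior_of_subset)

lemma open_intr: "openin X (intr P D)"
  by (simp add: intr_def)

lemma mesh_nonempty: "{} \<notin> mesh P"
  using intr_mesh_nonempty intr_subset by blast

text \<open>Mesh elements have disjoint interiors by assumption; regular closedness extends this to
  the boundaries of the other elements.\<close>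

lemma element_disjoint:
  assumes "\<tau> \<in> mesh P" "S \<subseteq> mesh P" "\<tau> \<notin> S"
  shows "intr P \<tau> \<inter> \<Union>S = {}"
proof -
  have "intr P \<tau> \<inter> \<sigma> = {}" if "\<sigma> \<in> S" for \<sigma>
  proof (rule disjoint_regular_closed[OF open_intr])
    show "regular_closed X \<sigma>"
      using regular_mesh_region[of "{\<sigma>}"] that assms(2) by auto
    show "intr P \<tau> \<inter> X interior_of \<sigma> = {}"
      using mesh_disjoint[OF assms(1), of \<sigma>] that assms(2,3) by (auto simp: intr_def)
  qed
  then show ?thesis by blast
qed

lemma a_space_subspace: "cfun.subspace (a_space P)"
  by (simp add: a_space_def)

lemma V_a_space: "v \<in> V \<Longrightarrow> v \<in> a_space P"
  and cut_a_space: "v \<in> V \<Longrightarrow> j \<in> I \<Longrightarrow> cut P j v \<in> a_space P"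
  by (auto simp: a_space_def cut_products_def intro!: cfun.span_base)

lemma a_on_psd: "S \<subseteq> mesh P \<Longrightarrow> psd_form (a_space P) (a_on P (\<Union>S))"
  using forms a_space_subspace unfolding psd_form_def forms_setting_def mesh_regions_def by blast

lemma a_on_vanish:
  assumes "S \<subseteq> mesh P" "u \<in> a_space P" "v \<in> a_space P" "\<And>x. x \<in> intr P (\<Union>S) \<Longrightarrow> u x = 0"
  shows "a_on P (\<Union>S) u v = 0" "a_on P (\<Union>S) v u = 0"
proof -
  have "\<Union>S \<in> mesh_regions (mesh P)" using assms(1) by (auto simp: mesh_regions_def)
  then show "a_on P (\<Union>S) u v = 0"
    using forms assms(2-4) unfolding forms_setting_def by simp
  then show "a_on P (\<Union>S) v u = 0"
    using psd_form.herm[OF a_on_psd[OF assms(1)] assms(3,2)] by simp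
qed

lemma a_on_Un:
  assumes "S \<subseteq> mesh P" "S' \<subseteq> mesh P" "intr P (\<Union>S) \<inter> intr P (\<Union>S') = {}"
    "u \<in> a_space P" "v \<in> a_space P"
  shows "a_on P (\<Union>S \<union> \<Union>S') u v = a_on P (\<Union>S) u v + a_on P (\<Union>S') u v"
proof -
  have "\<Union>S \<in> mesh_regions (mesh P)" "\<Union>S' \<in> mesh_regions (mesh P)"
    using assms(1,2) by (auto simp: mesh_regions_def)
  then show ?thesis using forms assms(3-5) unfolding forms_setting_def by simp
qed

lemma a_on_elements:
  assumes S: "S \<subseteq> mesh P" and uv: "u \<in> a_space P" "v \<in> a_space P"
  shows "a_on P (\<Union>S) u v = (\<Sum>\<tau>\<in>S. a_on P \<tau> u v)"
  using finite_subset[OF S finite_mesh] S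
proof (induction S rule: finite_induct)
  case empty
  \<comment> \<open>The empty union counts as a region too; its form is zero because every function
    vanishes on the empty interior.\<close>
  have "intr P {} = {}" using intr_subset by blast
  then show ?case using a_on_vanish(1)[of "{}", OF _ uv] by simp
next
  case (insert \<tau> S)
  have "intr P \<tau> \<inter> intr P (\<Union>S) = {}"
    using element_disjoint[of \<tau> S] insert.hyps insert.prems intr_subset by blast
  then have "a_on P (\<tau> \<union> \<Union>S) u v = a_on P \<tau> u v + a_on P (\<Union>S) u v"
    using a_on_Un[of "{\<tau>}" S, OF _ _ _ uv] insert.prems by simp
  then show ?case using insert by simp
qed

lemma a_elements: "u \<in> a_space P \<Longrightarrow> v \<in> a_space P \<Longrightarrow> a u v = (\<Sum>\<tau>\<in>mesh P. a_on P \<tau> u v)"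
  unfolding a_full_def Union_mesh[symmetric] by (rule a_on_elements) simp_all

text \<open>Elements outside \<open>S\<close> have interiors that miss the union of
  \<open>S\<close>, so u vanishes there and they contribute no energy.\<close>

lemma a_localize:
  assumes S: "S \<subseteq> mesh P" and uv: "u \<in> a_space P" "v \<in> a_space P"
    and supp: "\<And>x. u x \<noteq> 0 \<Longrightarrow> x \<in> \<Union>S"
  shows "a u v = a_on P (\<Union>S) u v"
proof -
  have z: "a_on P \<tau> u v = 0" if "\<tau> \<in> mesh P - S" for \<tau>
  proof -
    have "u x = 0" if "x \<in> intr P \<tau>" for x
      using element_disjoint[of \<tau> S] S supp[of x] that \<open>\<tau> \<in> mesh P - S\<close> by blast
    then show ?thesis using a_on_vanish(1)[of "{\<tau>}", OF _ uv] that by simp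
  qed
  show ?thesis
    unfolding a_elements[OF uv] a_on_elements[OF S uv]
    by (rule sum.mono_neutral_right[OF finite_mesh S ballI[OF z]])
qed

definition elems :: "nat \<Rightarrow> pt set set" where
  "elems i = {\<tau> \<in> mesh P. \<tau> \<subseteq> clD i}"

definition ext :: "nat \<Rightarrow> pt set set" where
  "ext i = (add_layer (mesh P) ^^ layers P i) (elems i)"

lemma elems_mesh: "elems i \<subseteq> mesh P"
  by (auto simp: elems_def)

lemma elems_ext: "elems i \<subseteq> ext i" and ext_mesh: "ext i \<subseteq> mesh P"
  using funpow_add_layer[OF elems_mesh mesh_nonempty] by (auto simp: ext_def)

text \<open>A region determines its elements: an element outside \<open>S\<close> has a nonempty
  interior missing the union of \<open>S\<close>, so it cannot be contained in that union.\<close>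

lemma sub_elems:
  assumes "i \<in> I"
  shows "clD i = \<Union>(elems i)" "sub P i = intr P (\<Union>(elems i))"
proof -
  obtain S where S: "S \<subseteq> mesh P" "sub P i = intr P (\<Union>S)"
    using bspec[OF sub_eq assms] by (elim exE conjE)
  have cl: "clD i = \<Union>S" using cl_intr S by simp
  have "\<tau> \<in> S" if "\<tau> \<in> mesh P" "\<tau> \<subseteq> \<Union>S" for \<tau>
    using element_disjoint[OF that(1) S(1)] intr_mesh_nonempty[OF that(1)] intr_subset[of \<tau>] that(2)
    by blast
  then have "elems i = S" using S(1) by (auto simp: elems_def cl)
  then show "clD i = \<Union>(elems i)" "sub P i = intr P (\<Union>(elems i))" using cl S by simp_all
qed

lemma elems_disjoint:
  assumes "i \<in> I" "k \<in> I" "i \<noteq> k"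
  shows "elems i \<inter> elems k = {}"
proof (rule ccontr)
  assume "\<not> ?thesis"
  then obtain \<tau> where \<tau>: "\<tau> \<in> elems i" "\<tau> \<in> elems k" by blast
  have "intr P \<tau> \<subseteq> sub P i" "intr P \<tau> \<subseteq> sub P k"
    unfolding sub_elems(2)[OF assms(1)] sub_elems(2)[OF assms(2)] intr_def
    using \<tau> by (intro interior_of_mono; blast)+
  moreover have "sub P i \<inter> sub P k = {}" using sub_disjoint assms by blast
  moreover have "\<tau> \<in> mesh P" using \<tau>(1) elems_mesh by blast
  ultimately show False using intr_mesh_nonempty[of \<tau>] by blast
qed

text \<open>An element belonging to no subdomain would have a nonempty interior outside all closed
  subdomains, yet these cover the domain.\<close>

lemma mesh_eq_elems: "mesh P = (\<Union>i\<in>I. elems i)"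
proof
  show "mesh P \<subseteq> (\<Union>i\<in>I. elems i)"
  proof (rule subsetI, rule ccontr)
    fix \<tau> assume \<tau>: "\<tau> \<in> mesh P" "\<tau> \<notin> (\<Union>i\<in>I. elems i)"
    have "intr P \<tau> \<inter> clD i = {}" if "i \<in> I" for i
      unfolding sub_elems(1)[OF that] using element_disjoint[OF \<tau>(1) elems_mesh] \<tau>(2) that by blast
    moreover have "\<tau> \<subseteq> (\<Union>i\<in>I. clD i)"
      unfolding sub_cover[symmetric] Union_mesh[symmetric] using \<tau>(1) by blast
    ultimately show False using intr_mesh_nonempty[OF \<tau>(1)] intr_subset[of \<tau>] by blast
  qed
qed (use elems_mesh in blast)

lemma a_subdomains:
  assumes "u \<in> a_space P" "v \<in> a_space P"
  shows "a u v = (\<Sum>i\<in>I. a_on P (clD i) u v)"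
proof -
  have "a u v = (\<Sum>i\<in>I. \<Sum>\<tau>\<in>elems i. a_on P \<tau> u v)"
    unfolding a_elements[OF assms] mesh_eq_elems
    using elems_disjoint finite_subset[OF elems_mesh finite_mesh]
    by (intro sum.UNION_disjoint) auto
  also have "\<dots> = (\<Sum>i\<in>I. a_on P (clD i) u v)"
    by (rule sum.cong[OF refl]) (simp only: sub_elems(1) a_on_elements[OF elems_mesh assms])
  finally show ?thesis .
qed

section \<open>Extended subdomains, neighbours and local spaces\<close>

lemma sub_ext_eq: "sub_ext P i = intr P (\<Union>(ext i))"
  by (simp add: sub_ext_def ext_def elems_def)

lemma cl_sub_ext: "cl P (sub_ext P i) = \<Union>(ext i)"
  using cl_intr[OF ext_mesh] by (simp add: sub_ext_eq)

lemma sub_subset_ext: "i \<in> I \<Longrightarrow> sub P i \<subseteq> sub_ext P i"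
  using elems_ext by (simp add: sub_elems(2) sub_ext_eq intr_def Union_mono interior_of_mono)

lemma nbrs_sym: "i \<in> I \<Longrightarrow> j \<in> I \<Longrightarrow> j \<in> nbrs P i \<longleftrightarrow> i \<in> nbrs P j"
  by (auto simp: nbrs_def)

text \<open>Passes from disjoint open extended subdomains to the closure of one of them, where
  supports of local functions and cutoffs actually lie.\<close>

lemma not_nbr_disjoint:
  assumes "j \<in> I" "j \<notin> nbrs P i"
  shows "sub_ext P i \<inter> \<Union>(ext j) = {}"
proof -
  have "sub_ext P i \<inter> sub_ext P j = {}" using assms by (auto simp: nbrs_def)
  then show ?thesis
    using disjoint_regular_closed[OF open_intr regular_mesh_region[OF ext_mesh]]
    by (simp add: sub_ext_eq intr_def)
qed

lemma cl_domain_subset: "cl P (domain_of P) \<subseteq> topspace X"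
  unfolding cl_def by (rule closure_of_subset_topspace)

lemma V_vanish: "u \<in> V \<Longrightarrow> x \<notin> cl P (domain_of P) \<Longrightarrow> u x = 0"
  using forms unfolding forms_setting_def by blast

lemma V_finite_dim: "finite_dim V"
  using forms unfolding forms_setting_def by blast

lemma V_subspace: "cfun.subspace V"
  using V_finite_dim by (auto simp: finite_dim_def)

lemma a_pd: "pd_form V a" and ip_pd: "pd_form V (ip P)"
  using forms V_subspace unfolding forms_setting_def pd_form_iff by blast+

lemma fe_local_eq: "fe_local P i = {u \<in> V. \<forall>x. u x \<noteq> 0 \<longrightarrow> x \<in> \<Union>(ext i)}"
proof -
  have "cl P {x. u x \<noteq> 0} \<subseteq> \<Union>(ext i) \<longleftrightarrow> {x. u x \<noteq> 0} \<subseteq> \<Union>(ext i)" if "u \<in> V" for u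
  proof
    \<comment> \<open>A set lies in its \<open>closure_of\<close> only when it lies in the carrier;
      functions of \<open>V\<close> satisfy this as they are extended by zero.\<close>
    have "{x. u x \<noteq> 0} \<subseteq> topspace X" using V_vanish[OF that] cl_domain_subset by blast
    then show "cl P {x. u x \<noteq> 0} \<subseteq> \<Union>(ext i) \<Longrightarrow> {x. u x \<noteq> 0} \<subseteq> \<Union>(ext i)"
      unfolding cl_def using closure_of_subset by blast
    show "{x. u x \<noteq> 0} \<subseteq> \<Union>(ext i) \<Longrightarrow> cl P {x. u x \<noteq> 0} \<subseteq> \<Union>(ext i)"
      unfolding cl_def
      by (rule closure_of_minimal[OF _ regular_closed_closedin[OF regular_mesh_region[OF ext_mesh]]])
  qed
  then have "u \<in> fe_local P i \<longleftrightarrow> u \<in> V \<and> (\<forall>x. u x \<noteq> 0 \<longrightarrow> x \<in> \<Union>(ext i))" for u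
    by (cases "u \<in> V") (simp_all only: fe_local_def cl_sub_ext mem_Collect_eq subset_iff simp_thms)
  then show ?thesis by (intro set_eqI) (simp only: mem_Collect_eq)
qed

lemma fe_local_V: "fe_local P i \<subseteq> V"
  by (auto simp: fe_local_eq)

lemma fe_local_subspace: "cfun.subspace (fe_local P i)"
  unfolding cfun.subspace_def fe_local_eq
proof (intro conjI ballI allI)
  fix u v and c :: complex
  assume u: "u \<in> {u \<in> V. \<forall>x. u x \<noteq> 0 \<longrightarrow> x \<in> \<Union>(ext i)}"
  show "cscale c u \<in> {u \<in> V. \<forall>x. u x \<noteq> 0 \<longrightarrow> x \<in> \<Union>(ext i)}"
    using u cfun.subspace_scale[OF V_subspace] by (auto simp: cscale_def)
  assume v: "v \<in> {u \<in> V. \<forall>x. u x \<noteq> 0 \<longrightarrow> x \<in> \<Union>(ext i)}"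
  have "u x + v x \<noteq> 0 \<Longrightarrow> x \<in> \<Union>(ext i)" for x
    using u v by (cases "u x = 0") simp_all
  then show "u + v \<in> {u \<in> V. \<forall>x. u x \<noteq> 0 \<longrightarrow> x \<in> \<Union>(ext i)}"
    using u v cfun.subspace_add[OF V_subspace, of u v] by (simp add: plus_fun_apply)
qed (simp add: cfun.subspace_0[OF V_subspace] zero_fun_apply)

text \<open>Local functions vanish outside the extended subdomain, so the form used in
  \<open>A_loc\<close> is \<open>a\<close> itself and a local solve becomes an
  \<open>a\<close>-orthogonal projection.\<close>

lemma a_local:
  assumes "u \<in> fe_local P j" "v \<in> V"
  shows "a_on P (cl P (sub_ext P j)) u v = a u v"
  unfolding cl_sub_ext
  using a_localize[OF ext_mesh, of u v j] assms V_a_space by (auto simp: fe_local_eq)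

lemma a_local_orthogonal:
  assumes j: "j \<in> I" "j \<notin> nbrs P i" and u: "u \<in> fe_local P i" and v: "v \<in> fe_local P j"
  shows "a u v = 0"
proof -
  have "u \<in> V" "v \<in> V" using u v fe_local_V by blast+
  then have uv: "u \<in> a_space P" "v \<in> a_space P" using V_a_space by blast+
  have "v x = 0" if "x \<in> intr P (\<Union>(ext i))" for x
    using not_nbr_disjoint[OF j] v that unfolding fe_local_eq sub_ext_eq by blast
  then have "a_on P (\<Union>(ext i)) u v = 0" by (rule a_on_vanish(2)[OF ext_mesh uv(2,1)])
  then show ?thesis using a_local[OF u \<open>v \<in> V\<close>] by (simp add: cl_sub_ext)
qed

text \<open>Complements the first assumption, which controls the energy of a cutoff product on
  subdomain i only for neighbours j of i.\<close>

lemma a_cut_vanish: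
  assumes i: "i \<in> I" and j: "j \<in> I" "j \<notin> nbrs P i" and w: "w \<in> V"
  shows "a_on P (clD i) (cut P j w) (cut P j w) = 0"
proof -
  have "cut P j w x = 0" if x: "x \<in> intr P (\<Union>(elems i))" for x
  proof (rule ccontr)
    let ?N = "{x \<in> cl P (domain_of P). cutoff P j x \<noteq> 0}"
    assume "cut P j w x \<noteq> 0"
    then have "x \<in> ?N" using V_vanish[OF w, of x] by (auto simp: cut_def)
    moreover have "?N \<subseteq> cl P ?N"
      unfolding cl_def using cl_domain_subset by (intro closure_of_subset) (auto simp: cl_def)
    moreover have "cl P ?N \<subseteq> \<Union>(ext j)"
      using cutoffs j(1) unfolding cutoff_setting_def cl_sub_ext[symmetric] by blast
    moreover have "x \<in> sub_ext P i" using sub_subset_ext[OF i] x by (auto simp: sub_elems(2)[OF i])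
    ultimately show False using not_nbr_disjoint[OF j] by blast
  qed
  then show ?thesis
    unfolding sub_elems(1)[OF i]
    by (rule a_on_vanish(1)[OF elems_mesh cut_a_space[OF w j(1)] cut_a_space[OF w j(1)]])
qed

subsection \<open>Interpolation and the local eigenproblems\<close>

abbreviation "M0 \<equiv> leb_on (sdim P) (domain_of P)"

lemma domain_subset_cl: "domain_of P \<subseteq> cl P (domain_of P)"
proof -
  have "domain_of P \<subseteq> topspace X"
    using geometry interior_of_subset_topspace
    unfolding geometry_setting_def polyhedral_domain_def by metis
  then show ?thesis unfolding cl_def by (rule closure_of_subset)
qed

lemma cutoff_bounds:
  assumes "j \<in> I" "x \<in> cl P (domain_of P)"
  shows "0 \<le> cutoff P j x" "cutoff P j x \<le> 1"
  using cutoffs assms unfolding cutoff_setting_def by simp_all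

lemma V_L2: "v \<in> V \<Longrightarrow> v \<in> L2 M0"
  using forms unfolding forms_setting_def by blast

text \<open>Linearity of the interpolation is available only on square integrable functions, so the
  cutoff products must be shown to be among them.\<close>

lemma cut_L2:
  assumes v: "v \<in> V" and j: "j \<in> I"
  shows "cut P j v \<in> L2 M0"
proof -
  have vm: "v \<in> borel_measurable M0" and vi: "integrable M0 (\<lambda>x. (cmod (v x))\<^sup>2)"
    using V_L2[OF v] by (simp_all add: L2_def)
  have cm: "cutoff P j \<in> borel_measurable M0"
    using cutoffs j unfolding cutoff_setting_def by simp
  have m: "cut P j v \<in> borel_measurable M0"
    unfolding cut_def using vm cm by measurable
  have "(cmod (cut P j v x))\<^sup>2 \<le> (cmod (v x))\<^sup>2" if "x \<in> space M0" for x
  proof -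
    have "x \<in> cl P (domain_of P)"
      using that domain_subset_cl by (auto simp: leb_on_def space_restrict_space)
    then have "cmod (cut P j v x) \<le> cmod (v x)"
      using cutoff_bounds[OF j] by (simp add: cut_def norm_mult mult_left_le_one_le)
    then show ?thesis by (simp add: power_mono)
  qed
  then have ae: "AE x in M0. norm ((cmod (cut P j v x))\<^sup>2) \<le> norm ((cmod (v x))\<^sup>2)"
    by (intro AE_I2) simp
  have "(\<lambda>x. (cmod (cut P j v x))\<^sup>2) \<in> borel_measurable M0" using m by measurable
  then have "integrable M0 (\<lambda>x. (cmod (cut P j v x))\<^sup>2)"
    by (rule Bochner_Integration.integrable_bound[OF vi _ ae])
  then show ?thesis using m by (simp add: L2_def)
qed

lemma sum_cut: "v \<in> V \<Longrightarrow> (\<Sum>j\<in>I. cut P j v) = v"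
proof (rule ext)
  fix x assume v: "v \<in> V"
  have "(\<Sum>j\<in>I. cut P j v) x = of_real (\<Sum>j\<in>I. cutoff P j x) * v x"
    by (simp add: sum_fun_apply cut_def sum_distrib_right)
  also have "\<dots> = v x"
  proof (cases "x \<in> cl P (domain_of P)")
    case True
    then show ?thesis using cutoffs unfolding cutoff_setting_def by simp
  next
    case False
    then show ?thesis using V_vanish[OF v] by simp
  qed
  finally show "(\<Sum>j\<in>I. cut P j v) x = v x" .
qed

lemma interp_add: "u \<in> L2 M0 \<Longrightarrow> v \<in> L2 M0 \<Longrightarrow> interp P (u + v) = interp P u + interp P v"
  using a2[unfolded assumption2_def, THEN conjunct1] by blast

lemma interp_fixed: "v \<in> V \<Longrightarrow> interp P v = v"
  and interp_cut: "v \<in> V \<Longrightarrow> i \<in> I \<Longrightarrow> interp P (cut P i v) \<in> fe_local P i"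
  using a2[unfolded assumption2_def, THEN conjunct2, THEN conjunct1] by blast+

lemma interp_stable:
  "u \<in> cut_products P \<Longrightarrow> \<tau> \<in> mesh P \<Longrightarrow>
    Re (a_on P \<tau> (interp P u) (interp P u)) \<le> CIa * Re (a_on P \<tau> u u)"
  using a2[unfolded assumption2_def, THEN conjunct2, THEN conjunct2] by blast

lemma interp_sum:
  "finite J \<Longrightarrow> (\<And>j. j \<in> J \<Longrightarrow> f j \<in> L2 M0) \<Longrightarrow> interp P (\<Sum>j\<in>J. f j) = (\<Sum>j\<in>J. interp P (f j))"
proof (induction J rule: finite_induct)
  case empty
  show ?case using interp_fixed[OF cfun.subspace_0[OF V_subspace]] by simp
next
  case (insert x F)
  have "f x \<in> L2 M0" "(\<Sum>j\<in>F. f j) \<in> L2 M0"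
    by (rule insert.prems, rule insertI1)
       (rule L2_sum[OF insert.hyps(1)], rule insert.prems, erule insertI2)
  from interp_add[OF this]
  have "interp P (f x + (\<Sum>j\<in>F. f j)) = interp P (f x) + interp P (\<Sum>j\<in>F. f j)" .
  also have "interp P (\<Sum>j\<in>F. f j) = (\<Sum>j\<in>F. interp P (f j))"
    by (rule insert.IH, rule insert.prems, erule insertI2)
  finally show ?case by (simp only: sum.insert[OF insert.hyps])
qed

lemma sum_interp_cut:
  assumes "v \<in> V"
  shows "(\<Sum>j\<in>I. interp P (cut P j v)) = v"
proof -
  have "interp P (\<Sum>j\<in>I. cut P j v) = (\<Sum>j\<in>I. interp P (cut P j v))"
    by (rule interp_sum[OF finite_atLeastAtMost cut_L2[OF assms]])
  then show ?thesis by (simp only: sum_cut[OF assms] interp_fixed[OF assms])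
qed

lemma interp_cut_V: "v \<in> V \<Longrightarrow> j \<in> I \<Longrightarrow> interp P (cut P j v) \<in> V"
  using interp_cut fe_local_V by blast

text \<open>Elementwise stability is summed over the mesh. No sign is prescribed for
  \<open>CIa\<close>; its absolute value is a valid and nonnegative constant because energies are
  nonnegative.\<close>

lemma interp_cut_energy:
  assumes v: "v \<in> V" and j: "j \<in> I"
  shows "Re (a (interp P (cut P j v)) (interp P (cut P j v)))
    \<le> \<bar>CIa\<bar> * Re (a (cut P j v) (cut P j v))"
proof -
  have c: "cut P j v \<in> cut_products P"
    using v j by (auto simp: cut_products_def)
  have "Re (a_on P \<tau> (interp P (cut P j v)) (interp P (cut P j v)))
      \<le> \<bar>CIa\<bar> * Re (a_on P \<tau> (cut P j v) (cut P j v))" if \<tau>: "\<tau> \<in> mesh P" for \<tau>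
  proof -
    have "Re (a_on P \<tau> (interp P (cut P j v)) (interp P (cut P j v)))
        \<le> CIa * Re (a_on P \<tau> (cut P j v) (cut P j v))"
      by (rule interp_stable[OF c \<tau>])
    also have "\<dots> \<le> \<bar>CIa\<bar> * Re (a_on P \<tau> (cut P j v) (cut P j v))"
      using psd_form.nonneg_Re[OF a_on_psd[of "{\<tau>}"] cut_a_space[OF v j]] \<tau>
      by (intro mult_right_mono) simp_all
    finally show ?thesis .
  qed
  then show ?thesis
    unfolding a_elements[OF cut_a_space[OF v j] cut_a_space[OF v j]]
      a_elements[OF V_a_space[OF interp_cut_V[OF v j]] V_a_space[OF interp_cut_V[OF v j]]]
      Re_sum sum_distrib_left
    by (rule sum_mono)
qed

section \<open>Local eigenproblems, the space of fine functions and the coarse space\<close>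

lemma F_subspace: "cfun.subspace (fe_restricted P i)"
  and F_finite_dim: "finite_dim (fe_restricted P i)"
  unfolding fe_restricted_def
  using restr_image_subspace[OF V_subspace] restr_image_finite_dim[OF V_finite_dim] by blast+

lemma sform_pd: "i \<in> I \<Longrightarrow> pd_form (fe_restricted P i) (sform P i)"
  using a1 F_subspace unfolding assumption1_def pd_form_iff by blast

text \<open>The eigenproblems live on restricted functions, while the form properties are known for
  global ones. Every restricted function is the restriction of some function in
  \<open>a_space P\<close>, and restriction is linear.\<close>

lemma aform_psd:
  assumes i: "i \<in> I"
  shows "psd_form (fe_restricted P i) (aform P (clD i))"
proof -
  interpret a: psd_form "a_space P" "a_on P (clD i)"
    unfolding sub_elems(1)[OF i] by (rule a_on_psd[OF elems_mesh])
  let ?F = "fe_restricted P i" and ?r = "restr (clD i)" and ?b = "aform P (clD i)"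
  have b: "?b (?r u) (?r v) = a_on P (clD i) u v" for u v
    by (simp add: a_on_def)
  have lift: "\<exists>u'\<in>a_space P. u = ?r u'" if "u \<in> ?F" for u
    using that V_a_space by (auto simp: fe_restricted_def)
  have "sesquilinear_on ?F ?b"
    unfolding sesquilinear_on_def
  proof (intro ballI allI)
    fix u v w c assume "u \<in> ?F" "v \<in> ?F" "w \<in> ?F"
    then obtain u' v' w' where *: "u' \<in> a_space P" "v' \<in> a_space P" "w' \<in> a_space P"
      "u = ?r u'" "v = ?r v'" "w = ?r w'"
      using lift by meson
    show "?b (u + v) w = ?b u w + ?b v w \<and> ?b (cscale c u) w = c * ?b u w \<and>
        ?b w (u + v) = ?b w u + ?b w v \<and> ?b w (cscale c u) = cnj c * ?b w u"
      unfolding *(4-6) restr_add[symmetric] restr_scale[symmetric] b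
      using *(1-3) by (simp add: a.add_left a.add_right a.scale_left a.scale_right)
  qed
  moreover have "hermitian_on ?F ?b"
    unfolding hermitian_on_def
  proof (intro ballI)
    fix u v assume "u \<in> ?F" "v \<in> ?F"
    then obtain u' v' where *: "u' \<in> a_space P" "v' \<in> a_space P" "u = ?r u'" "v = ?r v'"
      using lift by meson
    show "?b u v = cnj (?b v u)" unfolding *(3,4) b by (rule a.herm[OF *(1,2)])
  qed
  moreover have "\<forall>u\<in>?F. 0 \<le> Re (?b u u)"
  proof
    fix u assume "u \<in> ?F"
    then obtain u' where *: "u' \<in> a_space P" "u = ?r u'" using lift by meson
    show "0 \<le> Re (?b u u)" unfolding *(2) b by (rule a.nonneg_Re[OF *(1)])
  qed
  ultimately show ?thesis
    using F_subspace by (simp add: psd_form_def nonneg_form_on_def)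
qed

lemma eigenpairs:
  assumes "i \<in> I" "j \<in> {1..nloc P i}"
  shows "efun P i j \<in> fe_restricted P i" "0 < eval P i j"
    "w \<in> fe_restricted P i \<Longrightarrow>
      sform P i (efun P i j) w = of_real (eval P i j) * aform P (clD i) (efun P i j) w"
    "k \<in> {1..nloc P i} \<Longrightarrow> sform P i (efun P i j) (efun P i k) = (if j = k then 1 else 0)"
    "k \<in> {1..nloc P i} \<Longrightarrow> j \<le> k \<Longrightarrow> eval P i k \<le> eval P i j"
  using eigen assms unfolding local_eigenproblems_def by blast+

text \<open>\<open>aux_space\<close> selects eigenfunctions by counting. Since the eigenvalues
  decrease, those at or above the threshold form an initial segment, so the count selects the right
  ones.\<close>

lemma large_eigenvalue_index:
  assumes i: "i \<in> I" and j: "j \<in> {1..nloc P i}" and l: "threshold P \<le> eval P i j"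
  shows "j \<in> {1..nlarge P i}"
proof -
  have "{1..j} \<subseteq> {k \<in> {1..nloc P i}. threshold P \<le> eval P i k}"
  proof
    fix k assume k: "k \<in> {1..j}"
    then have "k \<in> {1..nloc P i}" using j by simp
    then show "k \<in> {k \<in> {1..nloc P i}. threshold P \<le> eval P i k}"
      using eigenpairs(5)[OF i _ j, of k] k l by force
  qed
  then have "card {1..j} \<le> nlarge P i" unfolding nlarge_def by (intro card_mono) auto
  then show ?thesis using j by simp
qed

lemma nlarge_le: "nlarge P i \<le> nloc P i"
proof -
  have "nlarge P i \<le> card {1..nloc P i}" unfolding nlarge_def by (rule card_mono) auto
  then show ?thesis by simp
qed

lemma aux_subset:
  assumes "i \<in> I"
  shows "aux_space P i \<subseteq> fe_restricted P i"
  unfolding aux_space_def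
  using eigenpairs(1)[OF assms] nlarge_le[of i] F_subspace
  by (intro cfun.span_minimal) auto

lemma restr_V: "v \<in> V \<Longrightarrow> restr (clD i) v \<in> fe_restricted P i"
  by (simp add: fe_restricted_def)

lemma tilde_V: "tilde_space P \<subseteq> V"
  by (auto simp: tilde_space_def)

lemma tilde_subspace: "cfun.subspace (tilde_space P)"
  unfolding cfun.subspace_def
proof (intro conjI ballI allI)
  have "sform P i (restr (clD i) 0) w = 0" if "i \<in> I" "w \<in> aux_space P i" for i w
    using psd_form.zero_left[OF pd_form.axioms(1)[OF sform_pd[OF that(1)]]] aux_subset that
    by (simp add: restr_zero subset_iff)
  then show "0 \<in> tilde_space P"
    using cfun.subspace_0[OF V_subspace] by (simp add: tilde_space_def)
  fix u v c assume u: "u \<in> tilde_space P"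
  have uV: "u \<in> V" using u tilde_V by blast
  have u0: "sform P i (restr (clD i) u) w = 0" if "i \<in> I" "w \<in> aux_space P i" for i w
    using u that unfolding tilde_space_def by blast
  have "sform P i (restr (clD i) (cscale c u)) w = 0" if "i \<in> I" "w \<in> aux_space P i" for i w
    using psd_form.scale_left[OF pd_form.axioms(1)[OF sform_pd[OF that(1)]]
        restr_V[OF uV] subsetD[OF aux_subset[OF that(1)] that(2)]] u0[OF that]
    by (simp add: restr_scale)
  then show "cscale c u \<in> tilde_space P"
    using cfun.subspace_scale[OF V_subspace uV] by (simp add: tilde_space_def)
  assume v: "v \<in> tilde_space P"
  have vV: "v \<in> V" using v tilde_V by blast
  have v0: "sform P i (restr (clD i) v) w = 0" if "i \<in> I" "w \<in> aux_space P i" for i w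
    using v that unfolding tilde_space_def by blast
  have "sform P i (restr (clD i) (u + v)) w = 0" if "i \<in> I" "w \<in> aux_space P i" for i w
    using psd_form.add_left[OF pd_form.axioms(1)[OF sform_pd[OF that(1)]]
        restr_V[OF uV] restr_V[OF vV] subsetD[OF aux_subset[OF that(1)] that(2)]]
      u0[OF that] v0[OF that]
    by (simp add: restr_add)
  then show "u + v \<in> tilde_space P"
    using cfun.subspace_add[OF V_subspace uV vV] by (simp add: tilde_space_def)
qed

lemma coarse_V: "coarse_space P \<subseteq> V"
  by (auto simp: coarse_space_def)

lemma coarse_subspace: "cfun.subspace (coarse_space P)"
proof -
  interpret a: pd_form V a by (rule a_pd)
  note t = subsetD[OF tilde_V]
  show ?thesis
    unfolding cfun.subspace_def coarse_space_def
    using a.mem_simps by (simp add: a.zero_left a.add_left a.scale_left t)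
qed

lemma tilde_spectral_bound:
  assumes i: "i \<in> I" and v: "v \<in> tilde_space P"
  shows "Re (s_on P i v v) \<le> threshold P * Re (a_on P (clD i) v v)"
  unfolding s_on_def a_on_def
proof (rule spectral_gap[where e = "efun P i" and l = "eval P i",
      OF sform_pd[OF i] aform_psd[OF i] F_finite_dim nloc_def])
  have vV: "v \<in> V" using v tilde_V by blast
  show "restr (clD i) v \<in> fe_restricted P i" by (rule restr_V[OF vV])
  fix j assume j: "j \<in> {1..nloc P i}"
  note eigenpairs[OF i j]
  then show "efun P i j \<in> fe_restricted P i" "0 < eval P i j"
    "\<And>w. w \<in> fe_restricted P i \<Longrightarrow>
      sform P i (efun P i j) w = of_real (eval P i j) * aform P (clD i) (efun P i j) w"
    "\<And>k. k \<in> {1..nloc P i} \<Longrightarrow> sform P i (efun P i j) (efun P i k) = (if j = k then 1 else 0)"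
    by blast+
  assume "threshold P \<le> eval P i j"
  then have "efun P i j \<in> aux_space P i"
    unfolding aux_space_def using large_eigenvalue_index[OF i j] by (blast intro: cfun.span_base)
  then show "sform P i (restr (clD i) v) (efun P i j) = 0"
    using v i unfolding tilde_space_def by blast
qed

subsection \<open>Stable decomposition and eigenvalue bounds\<close>

abbreviation "M \<equiv> real (max_nbrs P)"
abbreviation "\<Lambda> \<equiv> threshold P"

lemma card_nbrs: "i \<in> I \<Longrightarrow> real (card (nbrs P i)) \<le> M"
  unfolding max_nbrs_def by (intro of_nat_mono Max_ge finite_imageI imageI) simp_all

lemma threshold_gt_1: "1 < \<Lambda>"
  using eigen by (simp add: local_eigenproblems_def)

lemma Ct_pos: "0 < Ct"
  using a1 by (simp add: assumption1_def)

lemma cut_bound: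
  assumes i: "i \<in> I" and j: "j \<in> nbrs P i" and w: "w \<in> tilde_space P"
  shows "Re (a_on P (clD i) (cut P j w) (cut P j w)) \<le> Ct * (1 + \<Lambda>) * Re (a_on P (clD i) w w)"
proof -
  have wV: "w \<in> V" using w tilde_V by blast
  have "Re (a_on P (clD i) (cut P j w) (cut P j w))
      \<le> Ct * (Re (a_on P (clD i) w w) + Re (s_on P i w w))"
    using a1[unfolded assumption1_def, THEN conjunct2] i j wV by blast
  also have "\<dots> \<le> Ct * (Re (a_on P (clD i) w w) + \<Lambda> * Re (a_on P (clD i) w w))"
    using tilde_spectral_bound[OF i w] Ct_pos by simp
  finally show ?thesis by (simp add: algebra_simps)
qed

text \<open>Double counting over subdomains i and cutoffs j: on subdomain i at most M cutoff
  products have energy, each at most Ct (1 + \<Lambda>) times the energy of w there. Summing over i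
  restores the global energy of w.\<close>

lemma sum_cut_energy:
  assumes w: "w \<in> tilde_space P"
  shows "(\<Sum>j\<in>I. Re (a (cut P j w) (cut P j w))) \<le> M * Ct * (1 + \<Lambda>) * Re (a w w)"
proof -
  define K where "K i = Ct * (1 + \<Lambda>) * Re (a_on P (clD i) w w)" for i
  have wV: "w \<in> V" using w tilde_V by blast
  have K: "0 \<le> K i" if "i \<in> I" for i
    unfolding K_def sub_elems(1)[OF that]
    using psd_form.nonneg_Re[OF a_on_psd[OF elems_mesh] V_a_space[OF wV]] Ct_pos threshold_gt_1
    by simp
  have "(\<Sum>j\<in>I. Re (a (cut P j w) (cut P j w)))
      = (\<Sum>j\<in>I. \<Sum>i\<in>I. Re (a_on P (clD i) (cut P j w) (cut P j w)))"
    by (rule sum.cong[OF refl])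
       (simp only: a_subdomains[OF cut_a_space[OF wV] cut_a_space[OF wV]] Re_sum)
  also have "\<dots> \<le> (\<Sum>j\<in>I. \<Sum>i\<in>I. if j \<in> nbrs P i then K i else 0)"
  proof (intro sum_mono)
    fix j i assume "j \<in> I" "i \<in> I"
    then show "Re (a_on P (clD i) (cut P j w) (cut P j w)) \<le> (if j \<in> nbrs P i then K i else 0)"
      using a_cut_vanish[OF _ _ _ wV, of i j] cut_bound[OF _ _ w, of i j]
      by (cases "j \<in> nbrs P i") (simp_all add: K_def)
  qed
  also have "\<dots> = (\<Sum>i\<in>I. \<Sum>j\<in>I. if j \<in> nbrs P i then K i else 0)" by (rule sum.swap)
  also have "\<dots> = (\<Sum>i\<in>I. card (nbrs P i) * K i)"
  proof (rule sum.cong[OF refl])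
    fix i
    have "I \<inter> nbrs P i = nbrs P i" by (auto simp: nbrs_def)
    then show "(\<Sum>j\<in>I. if j \<in> nbrs P i then K i else 0) = card (nbrs P i) * K i"
      using sum.inter_restrict[of I "\<lambda>_. K i" "nbrs P i"] by simp
  qed
  also have "\<dots> \<le> (\<Sum>i\<in>I. M * K i)"
    by (rule sum_mono) (rule mult_right_mono[OF card_nbrs K])
  also have "\<dots> = M * Ct * (1 + \<Lambda>) * (\<Sum>i\<in>I. Re (a_on P (clD i) w w))"
    by (simp only: K_def sum_distrib_left mult.assoc)
  also have "(\<Sum>i\<in>I. Re (a_on P (clD i) w w)) = Re (a w w)"
    by (simp only: a_subdomains[OF V_a_space[OF wV] V_a_space[OF wV]] Re_sum)
  finally show ?thesis .
qed

text \<open>\<open>w\<close> is the \<open>a\<close>-projection of \<open>u\<close> onto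
  \<open>tilde_space P\<close>; the remainder is then coarse by definition, and Pythagoras bounds
  each part by \<open>u\<close>.\<close>

lemma coarse_tilde_decomposition:
  assumes u: "u \<in> V"
  obtains w where "w \<in> tilde_space P" "u - w \<in> coarse_space P"
    "Re (a (u - w) (u - w)) + Re (a w w) = Re (a u u)"
proof -
  interpret a: pd_form V a by (rule a_pd)
  obtain w where w: "w \<in> tilde_space P" "\<And>v. v \<in> tilde_space P \<Longrightarrow> a w v = a u v"
    using riesz[OF finite_dim_subspace[OF V_finite_dim tilde_subspace tilde_V]
        a.subset_pd[OF tilde_subspace tilde_V] a.antilinear[OF u tilde_V]]
    by metis
  have wV: "w \<in> V" using w(1) tilde_V by blast
  note d = a.mem_simps(3)[OF u wV]
  have orth: "a (u - w) v = 0" if "v \<in> tilde_space P" for v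
    using a.diff_left[OF u wV subsetD[OF tilde_V that]] w(2)[OF that] by simp
  have "Re (a u u) = Re (a (u - w + w) (u - w + w))" by simp
  also have "\<dots> = Re (a (u - w) (u - w)) + Re (a w w)"
    unfolding a.norm_add_sq[OF d wV] orth[OF w(1)] by simp
  finally have energy: "Re (a (u - w) (u - w)) + Re (a w w) = Re (a u u)" by simp
  have "u - w \<in> coarse_space P" using d orth by (simp add: coarse_space_def)
  then show ?thesis using that w(1) energy by blast
qed

section \<open>The preconditioned operator and its eigenvalues\<close>

definition space_of :: "nat \<Rightarrow> fn set" where
  "space_of j = (if j = 0 then coarse_space P else fe_local P j)"

text \<open>Index 0 is free because subdomains are numbered from 1. Giving it to the coarse
  correction makes all corrections one family, as the splitting lemma expects.\<close>

definition proj :: "nat \<Rightarrow> fn \<Rightarrow> fn" where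
  "proj j u = inv_into (space_of j) (if j = 0 then A_coarse P else A_loc P j)
     (adjoint_operator (space_of j) (ip P) id (A_h P u))"

text \<open>The 1 pays for the coarse component, the remaining product for the interpolated cutoff
  pieces of the fine component.\<close>

definition lower_const :: real where
  "lower_const = 1 + \<bar>CIa\<bar> * (M * Ct * (1 + \<Lambda>))"

lemma lower_const_ge_1: "1 \<le> lower_const"
  unfolding lower_const_def using Ct_pos threshold_gt_1 by simp

lemma space_of_subspace: "cfun.subspace (space_of j)" and space_of_V: "space_of j \<subseteq> V"
  unfolding space_of_def
  using coarse_subspace coarse_V fe_local_subspace fe_local_V by simp_all

lemma proj_props:
  assumes u: "u \<in> V"
  shows "proj j u \<in> space_of j" "v \<in> space_of j \<Longrightarrow> a (proj j u) v = a u v"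
proof -
  let ?a = "if j = 0 then a else a_on P (cl P (sub_ext P j))"
  have eq: "?a u v = a u v" if "u \<in> space_of j" "v \<in> space_of j" for u v
    using a_local[OF _ subsetD[OF fe_local_V]] that by (cases "j = 0") (simp_all add: space_of_def)
  have "proj j u = inv_into (space_of j) (form_operator (space_of j) (ip P) ?a)
     (adjoint_operator (space_of j) (ip P) id (form_operator V (ip P) a u))"
    by (simp add: proj_def space_of_def A_coarse_def A_loc_def A_h_def)
  then show "proj j u \<in> space_of j" "v \<in> space_of j \<Longrightarrow> a (proj j u) v = a u v"
    using local_solve_projection[OF V_finite_dim ip_pd a_pd space_of_subspace space_of_V eq u]
    by simp_all
qed

lemma B_inv_A_h: "(B_inv P \<circ> A_h P) u = (\<Sum>j\<in>{0..nsub P}. proj j u)"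
proof -
  have "(\<Sum>j\<in>{0..nsub P}. proj j u) = proj 0 u + (\<Sum>j\<in>I. proj j u)"
    using sum.atLeast_Suc_atMost[of 0 "nsub P" "\<lambda>j. proj j u"] by simp
  then show ?thesis by (simp add: B_inv_def proj_def space_of_def add.commute)
qed

text \<open>Testing the eigenvalue equation with u gives Re \<mu>, hence the lower bound on the
  modulus; taking energy norms on both sides gives the upper bound.\<close>

lemma eigenvalue_bounds:
  assumes u: "u \<in> V" "u \<noteq> 0" and \<mu>: "(B_inv P \<circ> A_h P) u = cscale \<mu> u"
  shows "1 / lower_const \<le> cmod \<mu>" "cmod \<mu> \<le> M + 1"
proof -
  interpret a: pd_form V a by (rule a_pd)
  let ?J = "{0..nsub P}"
  have pV: "proj j u \<in> V" for j using proj_props(1)[OF u(1)] space_of_V by blast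
  have self: "a (proj j u) (proj j u) = a u (proj j u)" for j
    by (rule proj_props(2)[OF u(1) proj_props(1)[OF u(1)]])
  have sum: "(\<Sum>j\<in>?J. proj j u) = cscale \<mu> u" using \<mu> by (simp only: B_inv_A_h)
  have pos: "0 < Re (a u u)" by (rule a.pos[OF u])
  obtain w where w: "w \<in> tilde_space P" "u - w \<in> coarse_space P"
    and split: "Re (a (u - w) (u - w)) + Re (a w w) = Re (a u u)"
    by (rule coarse_tilde_decomposition[OF u(1)])
  have wV: "w \<in> V" using w(1) tilde_V by blast
  have uwV: "u - w \<in> V" using w(2) coarse_V by blast
  define d where "d j = (if j = 0 then u - w else interp P (cut P j w))" for j
  have d: "d j \<in> space_of j" if "j \<in> ?J" for j
    using that w(2) interp_cut[OF wV, of j] by (simp add: d_def space_of_def)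
  have J: "(\<Sum>j\<in>?J. f j) = f 0 + (\<Sum>j\<in>I. f j)" for f :: "nat \<Rightarrow> 'c::comm_monoid_add"
    using sum.atLeast_Suc_atMost[of 0 "nsub P" f] by simp
  have "(\<Sum>j\<in>I. d j) = (\<Sum>j\<in>I. interp P (cut P j w))"
    by (rule sum.cong) (auto simp: d_def)
  then have "(\<Sum>j\<in>I. d j) = w" by (simp only: sum_interp_cut[OF wV])
  then have sum_d: "(\<Sum>j\<in>?J. d j) = u" unfolding J by (simp add: d_def)
  have stable: "(\<Sum>j\<in>?J. Re (a (d j) (d j))) \<le> lower_const * Re (a u u)"
  proof -
    have "(\<Sum>j\<in>I. Re (a (d j) (d j))) \<le> (\<Sum>j\<in>I. \<bar>CIa\<bar> * Re (a (cut P j w) (cut P j w)))"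
      by (rule sum_mono) (use interp_cut_energy[OF wV] in \<open>simp add: d_def\<close>)
    also have "\<dots> \<le> \<bar>CIa\<bar> * (M * Ct * (1 + \<Lambda>) * Re (a w w))"
      unfolding sum_distrib_left[symmetric]
      by (rule mult_left_mono[OF sum_cut_energy[OF w(1)]]) simp
    also have "\<dots> = (lower_const - 1) * Re (a w w)" by (simp add: lower_const_def)
    also have "\<dots> \<le> (lower_const - 1) * Re (a u u)"
      using lower_const_ge_1 split a.nonneg_Re[OF uwV] by (intro mult_left_mono) simp_all
    finally have "(\<Sum>j\<in>I. Re (a (d j) (d j))) \<le> (lower_const - 1) * Re (a u u)" .
    moreover have "Re (a (d 0) (d 0)) \<le> Re (a u u)"
      using split a.nonneg_Re[OF wV] by (simp add: d_def)
    ultimately show ?thesis unfolding J by (simp add: algebra_simps)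
  qed
  have "Re (a u u) \<le> lower_const * Re (a u (\<Sum>j\<in>?J. proj j u))"
    using lower_const_ge_1
    by (intro a.stable_splitting_lower_bound[OF u(1) subsetD[OF space_of_V d] pV sum_d
          proj_props(2)[OF u(1) d] self stable]) simp_all
  \<comment> \<open>Conjugate-linearity in the second argument produces the conjugate of \<mu>,
    which has the same real part, and \<open>a u u\<close> is real.\<close>
  also have "Re (a u (\<Sum>j\<in>?J. proj j u)) = Re \<mu> * Re (a u u)"
    unfolding sum a.scale_right[OF u(1) u(1)] using a.Im_self[OF u(1)] by simp
  finally have "1 \<le> lower_const * Re \<mu>"
    using pos mult_le_cancel_right[of 1 "Re (a u u)" "lower_const * Re \<mu>"] by (simp add: mult_ac)
  also have "\<dots> \<le> lower_const * cmod \<mu>"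
    using lower_const_ge_1 complex_Re_le_cmod by (intro mult_left_mono) simp_all
  finally show "1 / lower_const \<le> cmod \<mu>"
    using lower_const_ge_1 by (simp add: field_simps)
  \<comment> \<open>The coarse projection is the one-member case of the neighbour estimate, with
    constant 1. Treating it apart matters because the coarse space interacts with every local space;
    the triangle inequality then gives M + 1.\<close>
  have p0: "form_norm a (proj 0 u) \<le> form_norm a u"
  proof -
    have "(\<Sum>j\<in>{0::nat}. proj j u) = proj 0 u" by simp
    moreover have "form_norm a (\<Sum>j\<in>{0::nat}. proj j u) \<le> 1 * form_norm a u"
      by (rule a.sum_projections_norm_le[where N = "\<lambda>_. {0}"]) (simp_all add: u pV self)
    ultimately show ?thesis by simp
  qed
  have "form_norm a (\<Sum>j\<in>I. proj j u) \<le> M * form_norm a u"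
  proof (rule a.sum_projections_norm_le[where N = "nbrs P"])
    show "nbrs P i \<subseteq> I" for i by (auto simp: nbrs_def)
    fix i j assume ij: "i \<in> I" "j \<in> I" "j \<notin> nbrs P i"
    have "proj k u \<in> fe_local P k" if "k \<in> I" for k
      using proj_props(1)[OF u(1), of k] that by (simp add: space_of_def)
    then show "a (proj i u) (proj j u) = 0" using a_local_orthogonal ij by blast
  qed (use u(1) pV self card_nbrs nbrs_sym in simp_all)
  moreover have "form_norm a (cscale \<mu> u) \<le> form_norm a (proj 0 u) + form_norm a (\<Sum>j\<in>I. proj j u)"
    unfolding sum[symmetric] J by (rule a.norm_triangle[OF pV a.sum_mem[OF pV]])
  ultimately have "cmod \<mu> * form_norm a u \<le> (M + 1) * form_norm a u"
    using p0 by (simp add: a.norm_scale[OF u(1)] algebra_simps)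
  moreover have "0 < form_norm a u" using pos by (simp add: form_norm_def)
  ultimately show "cmod \<mu> \<le> M + 1" by simp
qed

lemma condition_number_bound: "cond_number V (B_inv P \<circ> A_h P) \<le> ereal ((M + 1) * lower_const)"
proof (rule cond_number_le)
  show "1 / lower_const \<le> cmod \<mu> \<and> cmod \<mu> \<le> M + 1"
    if "u \<in> V" "u \<noteq> 0" "(B_inv P \<circ> A_h P) u = cscale \<mu> u" for u \<mu>
    using eigenvalue_bounds[OF that] by simp
  show "0 < lower_const" using lower_const_ge_1 by simp
  show "0 < M + 1" by (rule add_nonneg_pos) simp_all
qed

end

theorem theorem2p6:
  fixes Ct CIa CIs :: real
  shows "\<exists>C :: real \<Rightarrow> nat \<Rightarrow> real. (\<forall>\<Lambda> M. 0 < C \<Lambda> M) \<and>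
    (\<forall>P. schwarz_setting P \<and> assumption1 Ct P \<and> assumption2 CIa CIs P \<longrightarrow>
       cond_number (fe_space P) (B_inv P \<circ> A_h P) \<le> ereal (C (threshold P) (max_nbrs P)))"
proof (intro exI conjI allI impI)
  \<comment> \<open>The product of the upper eigenvalue bound and \<open>lower_const\<close>.
    Absolute values keep it positive for all arguments; in the setting \<open>Ct\<close> and the
    threshold are positive, so nothing is lost there.\<close>
  let ?C = "\<lambda>\<Lambda> M. (real M + 1) * (1 + \<bar>CIa\<bar> * (real M * \<bar>Ct\<bar> * (1 + \<bar>\<Lambda>\<bar>)))"
  show "0 < ?C \<Lambda> M" for \<Lambda> M
    by (rule mult_pos_pos[OF add_nonneg_pos add_pos_nonneg]) auto
  fix P assume "schwarz_setting P \<and> assumption1 Ct P \<and> assumption2 CIa CIs P"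
  then interpret schwarz_problem P Ct CIa CIs
    by unfold_locales auto
  show "cond_number (fe_space P) (B_inv P \<circ> A_h P) \<le> ereal (?C (threshold P) (max_nbrs P))"
    using condition_number_bound Ct_pos threshold_gt_1 by (simp add: lower_const_def)
qed

end
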